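(* Let $\mathrm{WSys}(F_S\curvearrowright X)$ be a warped system induced by a free action by homeomorphisms of a finitely generated group $\Gamma=\langle S\mid R\rangle$ ($S$ finite, $R$ not necessarily finite). Then $\mathrm{WSys}(F_S\curvearrowright X)$ has stable discrete fundamental group if and only if $\Gamma$ is finitely presented.
   Context: Warped systems. Given an action by homeomorphisms of $F_S$, the free group on a finite set $S$, on a metric space $(X,d)$ (here the action factors through $F_S\to\Gamma$), for $t\ge1$ let $\delta_S^t$ be the largest metric on $X$ with $\delta_S^t\le t\cdot d$ and $\delta_S^t(x,s\cdot x)\le1$ for all $x\in X,s\in S$. The warped system $\mathrm{WSys}(F_S\curvearrowright X)$ is the family $\{(X,\delta_S^t)\}_{t\ge1}$ together with $S$. A jumping-path is a sequence of continuous paths $\gamma_0,\dots,\gamma_n$ in $X$ and $\vec s_1,\dots,\vec s_n\in S\cup S^{-1}$ with $\gamma_i(0)=\vec s_i\gamma_{i-1}(1)$; its length at scale $t$ is $n+\sum_i t\|\gamma_i\|$, where $\|\gamma_i\|$ is the length in $(X,d)$. $(X,\delta_S^t)$ is jumping-geodesic if $(X,d)$ is geodesic and any two points $x,y$ are joined by a jumping-path of length exactly $\delta_S^t(x,y)$ at scale $t$. Standing assumption on all warped systems: $(X,d)$ is compact, path-connected, locally path-connected, semi-locally simply connected, every continuous path in $X$ is homotopic (rel endpoints) to one of finite length, and $(X,\delta_S^t)$ is jumping-geodesic for all $t$ large enough. Discrete fundamental group. For a metric space $(Z,\rho)$ and $\theta>0$, a $\theta$-path is a sequence $(z_0,\dots,z_n)$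 with $\rho(z_i,z_{i+1})\le\theta$. Lazifications are obtained by repeating values; a $\theta$-grid homotopy between $\theta$-paths of length $n$ with the same endpoints is a $\theta$-Lipschitz map $\{0,\dots,n\}\times\{0,\dots,m\}\to Z$ ($\ell^1$ metric on the source) restricting to the two paths on the bottom and top rows and constant on the left and right sides. $\pi_{1,\theta}(Z)$ is the group of closed $\theta$-paths at a base point modulo the equivalence relation generated by lazifications and $\theta$-grid homotopies, with concatenation. Limit group. Fix $x_0\in X$ and, for $s\in S$, a continuous path $\alpha_s$ from $x_0$ to $s x_0$; put $\alpha_{s^{-1}}=s^{-1}(\alpha_s^* )$ ($^*$ denotes reversal) and $\alpha_{\vec s_1\cdots\vec s_n}=\alpha_{\vec s_1}\vec s_1(\alpha_{\vec s_2})\cdots(\vec s_1\cdots\vec s_{n-1})(\alpha_{\vec s_n})$. Let $\phi_S\colon F_S\to\mathrm{Aut}(\pi_1(X,x_0))$, $\phi_S(w)[\gamma]=[\alpha_w w(\gamma)\alpha_w^*]$. For integer $\theta\ge1$ let $K_\theta$ be the set of $([\beta w(\beta^* )\alpha_w^*],w)$ with $w\in F_S$ of reduced length $\le4\theta$ and $\mathrm{Fix}(w)\neq\emptyset$, and $\beta$ a path from $x_0$ to a point of $\mathrm{Fix}(w)$. For all $t$ large enough (depending on $\theta$) $\pi_{1,\theta}(X,\delta_S^t)$ is isomorphic to $(\pi_1(X,x_0)\rtimes_{\phi_S}F_S)/\langle\langle K_\theta\rangle\rangle$; this group is denoted $\pi_{1,\theta}(F_S\curvearrowright X)$. For $\theta<\theta'$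 the identity of $X$ induces the natural quotient map $\pi_{1,\theta}(F_S\curvearrowright X)\to\pi_{1,\theta'}(F_S\curvearrowright X)$, and $\pi_{1,\infty}(F_S\curvearrowright X)=\varinjlim_\theta\pi_{1,\theta}(F_S\curvearrowright X)$. The warped system has stable discrete fundamental group if for some $\theta$ the natural surjection $\pi_{1,\theta}(F_S\curvearrowright X)\to\pi_{1,\infty}(F_S\curvearrowright X)$ is an isomorphism. *)

theory Defs
  imports "HOL-Analysis.Analysis" "HOL-Algebra.Group_Action"
begin

section \<open>Free groups, normal closures and presentations\<close>

text \<open>A letter \<open>(s, True)\<close> stands for \<open>s\<close> and \<open>(s, False)\<close> for the formal inverse of \<open>s\<close>.
  Elements of the free group are the reduced words, so the reduced length is \<^const>\<open>length\<close>.\<close>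

type_synonym 's letter = "'s \<times> bool"

definition letter_inv :: "'s letter \<Rightarrow> 's letter"
  where "letter_inv a = (fst a, \<not> snd a)"

fun reduced_word :: "'s letter list \<Rightarrow> bool" where
  "reduced_word [] = True"
| "reduced_word [a] = True"
| "reduced_word (a # b # w) = (b \<noteq> letter_inv a \<and> reduced_word (b # w))"

fun cancel_cons :: "'s letter \<Rightarrow> 's letter list \<Rightarrow> 's letter list" where
  "cancel_cons a [] = [a]"
| "cancel_cons a (b # w) = (if b = letter_inv a then w else a # b # w)"

definition free_group :: "'s set \<Rightarrow> 's letter list monoid"
  where "free_group S =
    \<lparr>carrier = {w. reduced_word w \<and> fst ` set w \<subseteq> S},
     mult = (\<lambda>u v. foldr cancel_cons u v),
     one = []\<rparr>"

definition word_value :: "('g, 'm) monoid_scheme \<Rightarrow> ('s \<Rightarrow> 'g) \<Rightarrow> 's letter list \<Rightarrow> 'g"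
  where "word_value G \<iota> w =
    foldr (\<lambda>a g. (if snd a then \<iota> (fst a) else inv\<^bsub>G\<^esub> \<iota> (fst a)) \<otimes>\<^bsub>G\<^esub> g) w \<one>\<^bsub>G\<^esub>"

definition normal_closure :: "('a, 'm) monoid_scheme \<Rightarrow> 'a set \<Rightarrow> 'a set"
  where "normal_closure G K = \<Inter>{N. N \<lhd> G \<and> K \<subseteq> N}"

text \<open>\<open>G = \<langle>S | R\<rangle>\<close>, where the generating symbol \<open>s\<close> denotes \<open>\<iota> s\<close>; the map \<open>\<iota>\<close> need not be
  injective, and \<open>R\<close> may be infinite.\<close>

definition is_presentation ::
    "('g, 'm) monoid_scheme \<Rightarrow> 's set \<Rightarrow> ('s \<Rightarrow> 'g) \<Rightarrow> 's letter list set \<Rightarrow> bool"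
  where "is_presentation G S \<iota> R \<longleftrightarrow>
    group G \<and> \<iota> \<in> S \<rightarrow> carrier G \<and> R \<subseteq> carrier (free_group S) \<and>
    word_value G \<iota> ` carrier (free_group S) = carrier G \<and>
    kernel (free_group S) G (word_value G \<iota>) = normal_closure (free_group S) R"

text \<open>A finite set of generating symbols may always be taken to consist of natural numbers.\<close>

definition finitely_presented :: "('g, 'm) monoid_scheme \<Rightarrow> bool"
  where "finitely_presented G \<longleftrightarrow>
    (\<exists>(S :: nat set) \<iota> R. finite S \<and> finite R \<and> is_presentation G S \<iota> R)"

lemma letter_inv_letter_inv [simp]: "letter_inv (letter_inv a) = a"
  by (simp add: letter_inv_def)

lemma reduced_ConsD: "reduced_word (a # w) \<Longrightarrow> reduced_word w"
  by (cases w) auto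

lemma reduced_cancel_cons: "reduced_word w \<Longrightarrow> reduced_word (cancel_cons a w)"
  by (cases w) (auto dest: reduced_ConsD)

lemma reduced_foldr_cancel_cons: "reduced_word w \<Longrightarrow> reduced_word (foldr cancel_cons u w)"
  by (induction u) (auto intro: reduced_cancel_cons)

lemma cancel_cons_letter_inv: "reduced_word w \<Longrightarrow> cancel_cons (letter_inv a) (cancel_cons a w) = w"
  by (cases "(a, w)" rule: cancel_cons.cases; cases "tl w") auto

lemma foldr_cancel_cons_Nil: "reduced_word w \<Longrightarrow> foldr cancel_cons w [] = w"
proof (induction w)
  case (Cons a w)
  then show ?case by (cases w) auto
qed simp

lemma foldr_cancel_cons_cancel_cons:
  assumes "reduced_word w" "reduced_word v"
  shows "foldr cancel_cons (cancel_cons a v) w = cancel_cons a (foldr cancel_cons v w)"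
proof (cases v)
  case (Cons b v')
  have "reduced_word (foldr cancel_cons v' w)"
    using assms by (simp add: reduced_foldr_cancel_cons)
  then show ?thesis
    using Cons cancel_cons_letter_inv[of "foldr cancel_cons v' w" "letter_inv a"] by auto
qed simp

lemma foldr_cancel_cons_assoc:
  assumes "reduced_word w" "reduced_word v"
  shows "foldr cancel_cons (foldr cancel_cons u v) w = foldr cancel_cons u (foldr cancel_cons v w)"
  using assms
  by (induction u) (simp_all add: foldr_cancel_cons_cancel_cons reduced_foldr_cancel_cons)

lemma foldr_cancel_cons_inverse:
  "reduced_word v \<Longrightarrow> foldr cancel_cons (rev (map letter_inv w)) (foldr cancel_cons w v) = v"
  by (induction w) (simp_all add: cancel_cons_letter_inv reduced_foldr_cancel_cons)

lemma set_cancel_cons: "set (cancel_cons a w) \<subseteq> insert a (set w)"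
  by (cases w) auto

lemma set_foldr_cancel_cons: "set (foldr cancel_cons u w) \<subseteq> set u \<union> set w"
proof (induction u)
  case (Cons a u)
  then show ?case using set_cancel_cons[of a "foldr cancel_cons u w"] by auto
qed simp

lemma fst_set_foldr_cancel_cons:
  assumes "fst ` set u \<subseteq> S" "fst ` set w \<subseteq> S"
  shows "fst ` set (foldr cancel_cons u w) \<subseteq> S"
  using image_mono[OF set_foldr_cancel_cons, of fst u w] assms by (simp add: image_Un subset_trans)

lemma group_free_group: "group (free_group S)"
proof (rule groupI)
  fix u v assume "u \<in> carrier (free_group S)" "v \<in> carrier (free_group S)"
  then show "u \<otimes>\<^bsub>free_group S\<^esub> v \<in> carrier (free_group S)"
    by (simp add: free_group_def reduced_foldr_cancel_cons fst_set_foldr_cancel_cons)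
next
  fix u assume u: "u \<in> carrier (free_group S)"
  let ?v = "foldr cancel_cons (rev (map letter_inv u)) []"
  have "fst ` set (rev (map letter_inv u)) \<subseteq> S"
    using u by (auto simp: free_group_def letter_inv_def)
  then have "?v \<in> carrier (free_group S)"
    using fst_set_foldr_cancel_cons[of "rev (map letter_inv u)" S "[]"]
    by (simp add: free_group_def reduced_foldr_cancel_cons)
  moreover have "?v \<otimes>\<^bsub>free_group S\<^esub> u = \<one>\<^bsub>free_group S\<^esub>"
    using u foldr_cancel_cons_inverse[of "[]" u]
    by (simp add: free_group_def foldr_cancel_cons_assoc foldr_cancel_cons_Nil)
  ultimately show "\<exists>v\<in>carrier (free_group S). v \<otimes>\<^bsub>free_group S\<^esub> u = \<one>\<^bsub>free_group S\<^esub>"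
    by blast
qed (auto simp: free_group_def foldr_cancel_cons_assoc)

lemma word_value_Nil: "word_value G \<iota> [] = \<one>\<^bsub>G\<^esub>"
  by (simp add: word_value_def)

lemma word_value_Cons:
  "word_value G \<iota> (a # w) = 
    (if snd a then \<iota> (fst a) else inv\<^bsub>G\<^esub> \<iota> (fst a)) \<otimes>\<^bsub>G\<^esub> word_value G \<iota> w"
  by (simp add: word_value_def)

lemma word_value_closed:
  assumes "group G" "\<iota> \<in> S \<rightarrow> carrier G" "fst ` set w \<subseteq> S"
  shows "word_value G \<iota> w \<in> carrier G"
proof -
  interpret group G by fact
  show ?thesis
    using assms(2,3) by (induction w) (auto simp: word_value_Nil word_value_Cons)
qed

lemma word_value_cancel_cons:
  assumes "group G" "\<iota> \<in> S \<rightarrow> carrier G" "fst ` set (a # w) \<subseteq> S"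
  shows "word_value G \<iota> (cancel_cons a w) = word_value G \<iota> (a # w)"
proof (cases w)
  case (Cons b v)
  interpret group G by fact
  have "\<iota> (fst a) \<in> carrier G" using assms by auto
  moreover have "word_value G \<iota> v \<in> carrier G"
    using assms(3) Cons by (intro word_value_closed[OF assms(1,2)]) simp
  ultimately show ?thesis
    using Cons by (auto simp: word_value_Cons letter_inv_def m_assoc[symmetric])
qed simp

lemma word_value_hom:
  assumes "group G" "\<iota> \<in> S \<rightarrow> carrier G"
  shows "word_value G \<iota> \<in> hom (free_group S) G"
proof (rule homI)
  interpret group G by fact
  fix u v assume uv: "u \<in> carrier (free_group S)" "v \<in> carrier (free_group S)"
  then have v: "fst ` set v \<subseteq> S" by (simp add: free_group_def)
  have "fst ` set u \<subseteq> S" using uv by (simp add: free_group_def)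
  then have "word_value G \<iota> (foldr cancel_cons u v) = word_value G \<iota> u \<otimes>\<^bsub>G\<^esub> word_value G \<iota> v"
  proof (induction u)
    case Nil
    then show ?case using word_value_closed[OF assms v] by (simp add: word_value_Nil)
  next
    case (Cons a u)
    have "fst ` set (a # foldr cancel_cons u v) \<subseteq> S"
      using fst_set_foldr_cancel_cons[of u S v] Cons.prems v by simp
    moreover have "\<iota> (fst a) \<in> carrier G" using Cons.prems assms by auto
    ultimately show ?case
      using Cons v word_value_closed[OF assms]
      by (simp add: word_value_cancel_cons[OF assms] word_value_Cons m_assoc)
  qed
  then show "word_value G \<iota> (u \<otimes>\<^bsub>free_group S\<^esub> v) = word_value G \<iota> u \<otimes>\<^bsub>G\<^esub> word_value G \<iota> v"
    by (simp add: free_group_def)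
qed (simp add: free_group_def word_value_closed[OF assms])

section \<open>Actions\<close>

text \<open>Actions on \<open>X\<close> are in the sense of \<^locale>\<open>group_action\<close>; only the values on points
  of \<open>X\<close> are meaningful.\<close>

definition action_by_homeomorphisms ::
    "('g, 'm) monoid_scheme \<Rightarrow> 'a::topological_space set \<Rightarrow> ('g \<Rightarrow> 'a \<Rightarrow> 'a) \<Rightarrow> bool"
  where "action_by_homeomorphisms G X act \<longleftrightarrow>
    group_action G X act \<and> (\<forall>g\<in>carrier G. homeomorphism X X (act g) (act (inv\<^bsub>G\<^esub> g)))"

definition free_action :: "('g, 'm) monoid_scheme \<Rightarrow> 'a set \<Rightarrow> ('g \<Rightarrow> 'a \<Rightarrow> 'a) \<Rightarrow> bool"
  where "free_action G X act \<longleftrightarrow> (\<forall>g\<in>carrier G. \<forall>x\<in>X. act g x = x \<longrightarrow> g = \<one>\<^bsub>G\<^esub>)"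

definition induced_action ::
    "('g, 'm) monoid_scheme \<Rightarrow> ('s \<Rightarrow> 'g) \<Rightarrow> ('g \<Rightarrow> 'a \<Rightarrow> 'a) \<Rightarrow> 's letter list \<Rightarrow> 'a \<Rightarrow> 'a"
  where "induced_action G \<iota> act w = act (word_value G \<iota> w)"

lemma action_by_homeomorphisms_induced_action:
  assumes act: "action_by_homeomorphisms G X act" and \<iota>: "\<iota> \<in> S \<rightarrow> carrier G"
  shows "action_by_homeomorphisms (free_group S) X (induced_action G \<iota> act)"
proof -
  interpret act: group_action G X act
    using act by (simp add: action_by_homeomorphisms_def)
  have G: "group G" and B: "group (BijGroup X)"
    using act.group_hom by (simp_all add: group_hom_def)
  interpret w: group_hom "free_group S" G "word_value G \<iota>"
    using word_value_hom[OF G \<iota>] G group_free_group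
    by (simp add: group_hom_def group_hom_axioms_def)
  have "act \<circ> word_value G \<iota> \<in> hom (free_group S) (BijGroup X)"
    using act.group_hom by (intro hom_compose[OF w.homh]) (simp add: group_hom_def group_hom_axioms_def)
  moreover have "act \<circ> word_value G \<iota> = induced_action G \<iota> act"
    by (auto simp: induced_action_def)
  ultimately have "group_action (free_group S) X (induced_action G \<iota> act)"
    using B group_free_group by (simp add: group_action_def group_hom_def group_hom_axioms_def)
  moreover have "homeomorphism X X (induced_action G \<iota> act w)
      (induced_action G \<iota> act (inv\<^bsub>free_group S\<^esub> w))" if "w \<in> carrier (free_group S)" for w
    using act that by (simp add: action_by_homeomorphisms_def induced_action_def)
  ultimately show ?thesis by (simp add: action_by_homeomorphisms_def)
qed

section \<open>Warped systems\<close>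

text \<open>Throughout, \<open>X\<close> is a subset of a metric space, carrying the restricted metric, and
  \<open>\<rho>\<close> is an action of \<^term>\<open>free_group S\<close> on \<open>X\<close>.  Continuous paths in \<open>X\<close> are parametrised
  by the unit interval.\<close>

definition path_in :: "'a::topological_space set \<Rightarrow> 'a \<Rightarrow> 'a \<Rightarrow> (real \<Rightarrow> 'a) \<Rightarrow> bool"
  where "path_in X x y \<gamma> \<longleftrightarrow>
    path \<gamma> \<and> path_image \<gamma> \<subseteq> X \<and> pathstart \<gamma> = x \<and> pathfinish \<gamma> = y"

definition path_length :: "(real \<Rightarrow> 'a::metric_space) \<Rightarrow> ennreal"
  where "path_length \<gamma> =
    (SUP ts\<in>{ts. sorted ts \<and> set ts \<subseteq> {0..1}}.
      \<Sum>i<length ts - 1. ennreal (dist (\<gamma> (ts ! i)) (\<gamma> (ts ! Suc i))))"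

definition geodesic_space :: "'a::metric_space set \<Rightarrow> bool"
  where "geodesic_space X \<longleftrightarrow>
    (\<forall>x\<in>X. \<forall>y\<in>X. \<exists>\<gamma>. \<gamma> ` {0..dist x y} \<subseteq> X \<and> \<gamma> 0 = x \<and> \<gamma> (dist x y) = y \<and>
      (\<forall>a\<in>{0..dist x y}. \<forall>b\<in>{0..dist x y}. dist (\<gamma> a) (\<gamma> b) = \<bar>a - b\<bar>))"

definition semilocally_simply_connected :: "'a::topological_space set \<Rightarrow> bool"
  where "semilocally_simply_connected X \<longleftrightarrow>
    (\<forall>x\<in>X. \<exists>U. openin (top_of_set X) U \<and> x \<in> U \<and>
      (\<forall>\<gamma>. path_in U x x \<gamma> \<longrightarrow> homotopic_paths X \<gamma> (\<lambda>_. x)))"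

definition warped_admissible ::
    "'a::metric_space set \<Rightarrow> 's set \<Rightarrow> ('s letter list \<Rightarrow> 'a \<Rightarrow> 'a) \<Rightarrow> real \<Rightarrow> ('a \<Rightarrow> 'a \<Rightarrow> real) \<Rightarrow> bool"
  where "warped_admissible X S \<rho> t \<delta> \<longleftrightarrow>
    Metric_space X \<delta> \<and>
    (\<forall>x\<in>X. \<forall>y\<in>X. \<delta> x y \<le> t * dist x y) \<and>
    (\<forall>x\<in>X. \<forall>s\<in>S. \<delta> x (\<rho> [(s, True)] x) \<le> 1)"

text \<open>The warped metric \<open>\<delta>\<^sub>S\<^sup>t\<close> is characterised by this predicate, uniquely on points of \<open>X\<close>.\<close>

definition is_warped_metric ::
    "'a::metric_space set \<Rightarrow> 's set \<Rightarrow> ('s letter list \<Rightarrow> 'a \<Rightarrow> 'a) \<Rightarrow> real \<Rightarrow> ('a \<Rightarrow> 'a \<Rightarrow> real) \<Rightarrow> bool"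
  where "is_warped_metric X S \<rho> t \<delta> \<longleftrightarrow>
    warped_admissible X S \<rho> t \<delta> \<and>
    (\<forall>\<delta>'. warped_admissible X S \<rho> t \<delta>' \<longrightarrow> (\<forall>x\<in>X. \<forall>y\<in>X. \<delta>' x y \<le> \<delta> x y))"

text \<open>The jumping-path consists of the paths \<open>\<gamma> 0, \<dots>, \<gamma> n\<close> and the letters \<open>a 1, \<dots>, a n\<close>.\<close>

definition jumping_path ::
    "'a::metric_space set \<Rightarrow> 's set \<Rightarrow> ('s letter list \<Rightarrow> 'a \<Rightarrow> 'a) \<Rightarrow> 'a \<Rightarrow> 'a \<Rightarrow>
     nat \<Rightarrow> (nat \<Rightarrow> real \<Rightarrow> 'a) \<Rightarrow> (nat \<Rightarrow> 's letter) \<Rightarrow> bool"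
  where "jumping_path X S \<rho> x y n \<gamma> a \<longleftrightarrow>
    (\<forall>i\<le>n. path (\<gamma> i) \<and> path_image (\<gamma> i) \<subseteq> X) \<and>
    pathstart (\<gamma> 0) = x \<and> pathfinish (\<gamma> n) = y \<and>
    (\<forall>i\<in>{1..n}. fst (a i) \<in> S \<and> pathstart (\<gamma> i) = \<rho> [a i] (pathfinish (\<gamma> (i - 1))))"

definition jumping_length :: "real \<Rightarrow> nat \<Rightarrow> (nat \<Rightarrow> real \<Rightarrow> 'a::metric_space) \<Rightarrow> ennreal"
  where "jumping_length t n \<gamma> = of_nat n + (\<Sum>i\<le>n. ennreal t * path_length (\<gamma> i))"

definition jumping_geodesic ::
    "'a::metric_space set \<Rightarrow> 's set \<Rightarrow> ('s letter list \<Rightarrow> 'a \<Rightarrow> 'a) \<Rightarrow> real \<Rightarrow> bool"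
  where "jumping_geodesic X S \<rho> t \<longleftrightarrow>
    geodesic_space X \<and>
    (\<exists>\<delta>. is_warped_metric X S \<rho> t \<delta> \<and>
      (\<forall>x\<in>X. \<forall>y\<in>X. \<exists>n \<gamma> a. jumping_path X S \<rho> x y n \<gamma> a \<and>
        jumping_length t n \<gamma> = ennreal (\<delta> x y)))"

definition warped_system ::
    "'a::metric_space set \<Rightarrow> 's set \<Rightarrow> ('s letter list \<Rightarrow> 'a \<Rightarrow> 'a) \<Rightarrow> bool"
  where "warped_system X S \<rho> \<longleftrightarrow>
    finite S \<and> action_by_homeomorphisms (free_group S) X \<rho> \<and>
    compact X \<and> path_connected X \<and> locally path_connected X \<and>
    semilocally_simply_connected X \<and>
    (\<forall>\<gamma>. path \<gamma> \<and> path_image \<gamma> \<subseteq> X \<longrightarrow>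
      (\<exists>\<gamma>'. homotopic_paths X \<gamma> \<gamma>' \<and> path_length \<gamma>' < \<infinity>)) \<and>
    (\<exists>t\<^sub>0\<ge>1. \<forall>t\<ge>t\<^sub>0. jumping_geodesic X S \<rho> t)"

section \<open>The limit groups\<close>

definition path_class :: "'a::topological_space set \<Rightarrow> (real \<Rightarrow> 'a) \<Rightarrow> (real \<Rightarrow> 'a) set"
  where "path_class X \<gamma> = {\<gamma>'. homotopic_paths X \<gamma> \<gamma>'}"

definition fundamental_group :: "'a::topological_space set \<Rightarrow> 'a \<Rightarrow> (real \<Rightarrow> 'a) set monoid"
  where "fundamental_group X x\<^sub>0 =
    \<lparr>carrier = path_class X ` {\<gamma>. path_in X x\<^sub>0 x\<^sub>0 \<gamma>},
     mult = (\<lambda>A B. \<Union>\<gamma>\<in>A. \<Union>\<gamma>'\<in>B. path_class X (\<gamma> +++ \<gamma>')),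
     one = path_class X (\<lambda>_. x\<^sub>0)\<rparr>"

definition letter_path ::
    "('s letter list \<Rightarrow> 'a \<Rightarrow> 'a) \<Rightarrow> ('s \<Rightarrow> real \<Rightarrow> 'a) \<Rightarrow> 's letter \<Rightarrow> real \<Rightarrow> 'a::topological_space"
  where "letter_path \<rho> \<alpha> a =
    (if snd a then \<alpha> (fst a) else \<rho> [a] \<circ> reversepath (\<alpha> (fst a)))"

text \<open>\<open>\<alpha>\<^sub>w\<close>, with a constant path appended at the end; it is only used up to homotopy.\<close>

fun word_path ::
    "('s letter list \<Rightarrow> 'a \<Rightarrow> 'a) \<Rightarrow> 'a \<Rightarrow> ('s \<Rightarrow> real \<Rightarrow> 'a) \<Rightarrow> 's letter list \<Rightarrow> real \<Rightarrow> 'a::topological_space"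
  where
  "word_path \<rho> x\<^sub>0 \<alpha> [] = (\<lambda>_. x\<^sub>0)"
| "word_path \<rho> x\<^sub>0 \<alpha> (a # w) = letter_path \<rho> \<alpha> a +++ (\<rho> [a] \<circ> word_path \<rho> x\<^sub>0 \<alpha> w)"

definition word_automorphism ::
    "'a::topological_space set \<Rightarrow> ('s letter list \<Rightarrow> 'a \<Rightarrow> 'a) \<Rightarrow> 'a \<Rightarrow> ('s \<Rightarrow> real \<Rightarrow> 'a) \<Rightarrow>
     's letter list \<Rightarrow> (real \<Rightarrow> 'a) set \<Rightarrow> (real \<Rightarrow> 'a) set"
  where "word_automorphism X \<rho> x\<^sub>0 \<alpha> w A =
    (\<Union>\<gamma>\<in>A. path_class X
      (word_path \<rho> x\<^sub>0 \<alpha> w +++ ((\<rho> w \<circ> \<gamma>) +++ reversepath (word_path \<rho> x\<^sub>0 \<alpha> w))))"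

definition semidirect_product ::
    "('n, 'k) monoid_scheme \<Rightarrow> ('h \<Rightarrow> 'n \<Rightarrow> 'n) \<Rightarrow> ('h, 'l) monoid_scheme \<Rightarrow> ('n \<times> 'h) monoid"
  where "semidirect_product N act H =
    \<lparr>carrier = carrier N \<times> carrier H,
     mult = (\<lambda>(n, h) (n', h'). (n \<otimes>\<^bsub>N\<^esub> act h n', h \<otimes>\<^bsub>H\<^esub> h')),
     one = (\<one>\<^bsub>N\<^esub>, \<one>\<^bsub>H\<^esub>)\<rparr>"

definition ambient_group ::
    "'a::topological_space set \<Rightarrow> 's set \<Rightarrow> ('s letter list \<Rightarrow> 'a \<Rightarrow> 'a) \<Rightarrow> 'a \<Rightarrow> ('s \<Rightarrow> real \<Rightarrow> 'a) \<Rightarrow>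
     ((real \<Rightarrow> 'a) set \<times> 's letter list) monoid"
  where "ambient_group X S \<rho> x\<^sub>0 \<alpha> =
    semidirect_product (fundamental_group X x\<^sub>0) (word_automorphism X \<rho> x\<^sub>0 \<alpha>) (free_group S)"

definition fixed_point_relators ::
    "'a::topological_space set \<Rightarrow> 's set \<Rightarrow> ('s letter list \<Rightarrow> 'a \<Rightarrow> 'a) \<Rightarrow> 'a \<Rightarrow> ('s \<Rightarrow> real \<Rightarrow> 'a) \<Rightarrow>
     nat \<Rightarrow> ((real \<Rightarrow> 'a) set \<times> 's letter list) set"
  where "fixed_point_relators X S \<rho> x\<^sub>0 \<alpha> \<theta> =
    {(path_class X (\<beta> +++ ((\<rho> w \<circ> reversepath \<beta>) +++ reversepath (word_path \<rho> x\<^sub>0 \<alpha> w))), w) | w \<beta> p.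
      w \<in> carrier (free_group S) \<and> length w \<le> 4 * \<theta> \<and>
      p \<in> X \<and> \<rho> w p = p \<and> path_in X x\<^sub>0 p \<beta>}"

definition relator_subgroup ::
    "'a::topological_space set \<Rightarrow> 's set \<Rightarrow> ('s letter list \<Rightarrow> 'a \<Rightarrow> 'a) \<Rightarrow> 'a \<Rightarrow> ('s \<Rightarrow> real \<Rightarrow> 'a) \<Rightarrow>
     nat \<Rightarrow> ((real \<Rightarrow> 'a) set \<times> 's letter list) set"
  where "relator_subgroup X S \<rho> x\<^sub>0 \<alpha> \<theta> =
    normal_closure (ambient_group X S \<rho> x\<^sub>0 \<alpha>) (fixed_point_relators X S \<rho> x\<^sub>0 \<alpha> \<theta>)"

text \<open>The group \<open>\<pi>\<^bsub>1,\<theta>\<^esub>(F\<^sub>S \<curvearrowright> X)\<close>, defined as this quotient; it is isomorphic to the group of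
  closed \<open>\<theta>\<close>-paths in \<open>(X, \<delta>\<^sub>S\<^sup>t)\<close> modulo lazifications and \<open>\<theta>\<close>-grid homotopies for all large \<open>t\<close>.\<close>

definition discrete_fundamental_group ::
    "'a::topological_space set \<Rightarrow> 's set \<Rightarrow> ('s letter list \<Rightarrow> 'a \<Rightarrow> 'a) \<Rightarrow> 'a \<Rightarrow> ('s \<Rightarrow> real \<Rightarrow> 'a) \<Rightarrow>
     nat \<Rightarrow> ((real \<Rightarrow> 'a) set \<times> 's letter list) set monoid"
  where "discrete_fundamental_group X S \<rho> x\<^sub>0 \<alpha> \<theta> =
    ambient_group X S \<rho> x\<^sub>0 \<alpha> Mod relator_subgroup X S \<rho> x\<^sub>0 \<alpha> \<theta>"

text \<open>The natural quotient map \<open>N g \<mapsto> N' g\<close> from the group at \<open>\<theta>\<close> to the group at \<open>\<theta>' \<ge> \<theta>\<close>,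
  where \<open>N \<subseteq> N'\<close> are the respective relator subgroups: as a product of sets, \<open>N' (N g) = N' g\<close>.\<close>

definition transition_map ::
    "'a::topological_space set \<Rightarrow> 's set \<Rightarrow> ('s letter list \<Rightarrow> 'a \<Rightarrow> 'a) \<Rightarrow> 'a \<Rightarrow> ('s \<Rightarrow> real \<Rightarrow> 'a) \<Rightarrow>
     nat \<Rightarrow> nat \<Rightarrow> ((real \<Rightarrow> 'a) set \<times> 's letter list) set \<Rightarrow> ((real \<Rightarrow> 'a) set \<times> 's letter list) set"
  where "transition_map X S \<rho> x\<^sub>0 \<alpha> \<theta> \<theta>' C =
    relator_subgroup X S \<rho> x\<^sub>0 \<alpha> \<theta>' <#>\<^bsub>ambient_group X S \<rho> x\<^sub>0 \<alpha>\<^esub> C"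

text \<open>Direct limit of groups \<open>H i\<close>, \<open>i \<in> I\<close>, along homomorphisms \<open>f i j\<close> from \<open>H i\<close> to \<open>H j\<close> for
  \<open>i \<le> j\<close>: the disjoint union modulo eventual equality.\<close>

definition direct_limit_rel ::
    "nat set \<Rightarrow> (nat \<Rightarrow> ('b, 'm) monoid_scheme) \<Rightarrow> (nat \<Rightarrow> nat \<Rightarrow> 'b \<Rightarrow> 'b) \<Rightarrow>
     ((nat \<times> 'b) \<times> (nat \<times> 'b)) set"
  where "direct_limit_rel I H f =
    {((i, x), (j, y)) | i x j y. i \<in> I \<and> x \<in> carrier (H i) \<and> j \<in> I \<and> y \<in> carrier (H j) \<and>
      (\<exists>k\<in>I. i \<le> k \<and> j \<le> k \<and> f i k x = f j k y)}"

definition direct_limit_map ::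
    "nat set \<Rightarrow> (nat \<Rightarrow> ('b, 'm) monoid_scheme) \<Rightarrow> (nat \<Rightarrow> nat \<Rightarrow> 'b \<Rightarrow> 'b) \<Rightarrow>
     nat \<Rightarrow> 'b \<Rightarrow> (nat \<times> 'b) set"
  where "direct_limit_map I H f i x = direct_limit_rel I H f `` {(i, x)}"

definition direct_limit ::
    "nat set \<Rightarrow> (nat \<Rightarrow> ('b, 'm) monoid_scheme) \<Rightarrow> (nat \<Rightarrow> nat \<Rightarrow> 'b \<Rightarrow> 'b) \<Rightarrow> (nat \<times> 'b) set monoid"
  where "direct_limit I H f =
    \<lparr>carrier = (SIGMA i:I. carrier (H i)) // direct_limit_rel I H f,
     mult = (\<lambda>A B. \<Union>(i, x)\<in>A. \<Union>(j, y)\<in>B.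
       direct_limit_map I H f (max i j) (f i (max i j) x \<otimes>\<^bsub>H (max i j)\<^esub> f j (max i j) y)),
     one = (\<Union>i\<in>I. direct_limit_map I H f i \<one>\<^bsub>H i\<^esub>)\<rparr>"

definition stable_discrete_fundamental_group ::
    "'a::topological_space set \<Rightarrow> 's set \<Rightarrow> ('s letter list \<Rightarrow> 'a \<Rightarrow> 'a) \<Rightarrow> 'a \<Rightarrow> ('s \<Rightarrow> real \<Rightarrow> 'a) \<Rightarrow> bool"
  where "stable_discrete_fundamental_group X S \<rho> x\<^sub>0 \<alpha> \<longleftrightarrow>
    (let H = discrete_fundamental_group X S \<rho> x\<^sub>0 \<alpha>; f = transition_map X S \<rho> x\<^sub>0 \<alpha> in
      \<exists>\<theta>\<ge>1. direct_limit_map {1..} H f \<theta> \<in> iso (H \<theta>) (direct_limit {1..} H f))"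

end

theory Submission
  imports Defs "HOL-Algebra.Generated_Groups"
begin

text \<open>A word with a fixed point acts trivially, because the action of \<open>\<Gamma>\<close> is free; so the relators of
  \<open>\<pi>\<^bsub>1,\<theta>\<^esub>\<close> are the pairs \<open>\<sigma>(w) = ([\<alpha>\<^sub>w]\<^sup>-\<^sup>1, w)\<close> where \<open>w\<close> runs through the words of length at most
  \<open>4\<theta>\<close> in \<open>K = ker(F\<^sub>S \<rightarrow> \<Gamma>)\<close>.  On \<open>K\<close> the map \<open>\<sigma>\<close> is a homomorphism, and it turns conjugation by
  \<open>u \<in> F\<^sub>S\<close> into conjugation by \<open>(1, u)\<close>.  Hence \<open>\<sigma>(w)\<close> lies in the normal closure of the relators
  iff \<open>w\<close> lies in the normal closure in \<open>F\<^sub>S\<close> of the words of length at most \<open>4\<theta>\<close> in \<open>K\<close>.  The quotients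
  stabilise iff these normal closures reach \<open>K\<close> at a finite stage, that is, iff \<open>K\<close> is normally
  generated by finitely many words.\<close>

section \<open>Normal closures\<close>

lemma (in group) normal_normal_closure:
  assumes "K \<subseteq> carrier G"
  shows "normal_closure G K \<lhd> G"
proof (rule normal_invI)
  \<comment> \<open>The whole group belongs to the family. An intersection over an empty family
    would be the whole type rather than a subgroup.\<close>
  have ne: "{N. N \<lhd> G \<and> K \<subseteq> N} \<noteq> {}"
    using normal_self assms by blast
  then show "subgroup (normal_closure G K) G"
    unfolding normal_closure_def by (intro subgroups_Inter) (auto dest: normal_imp_subgroup)
  fix x h assume "x \<in> carrier G" "h \<in> normal_closure G K"
  then show "x \<otimes> h \<otimes> inv x \<in> normal_closure G K"
    by (auto simp: normal_closure_def intro: normal.inv_op_closed2)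
qed

lemma subset_normal_closure: "K \<subseteq> normal_closure G K"
  by (auto simp: normal_closure_def)

lemma normal_closure_minimal: "N \<lhd> G \<Longrightarrow> K \<subseteq> N \<Longrightarrow> normal_closure G K \<subseteq> N"
  by (auto simp: normal_closure_def)

lemma (in group) normal_closure_mono:
  assumes "K \<subseteq> L" "L \<subseteq> carrier G"
  shows "normal_closure G K \<subseteq> normal_closure G L"
  using assms subset_normal_closure[of L G] normal_normal_closure[of L]
  by (intro normal_closure_minimal) auto

lemma (in group_hom) normal_preimage:
  assumes "N \<lhd> H"
  shows "{x \<in> carrier G. h x \<in> N} \<lhd> G"
proof (rule G.normal_invI)
  interpret N: normal N H by fact
  show "subgroup {x \<in> carrier G. h x \<in> N} G"
    by (rule G.subgroupI) auto
  fix x y assume "x \<in> carrier G" "y \<in> {x \<in> carrier G. h x \<in> N}"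
  then show "x \<otimes> y \<otimes> inv x \<in> {x \<in> carrier G. h x \<in> N}"
    by (auto intro: N.inv_op_closed2)
qed

text \<open>The preimage of a normal subgroup is normal. If it contains \<open>K\<close> it contains
  the normal closure of \<open>K\<close>, so membership of images need only be checked on normal
  generators.\<close>

lemma (in group_hom) hom_normal_closure:
  assumes "N \<lhd> H" "K \<subseteq> carrier G" "h ` K \<subseteq> N" "x \<in> normal_closure G K"
  shows "h x \<in> N"
  using normal_closure_minimal[OF normal_preimage[OF assms(1)], of K] assms(2-4) by auto

section \<open>Finite presentations\<close>

lemma Nil_in_free_group [simp]: "[] \<in> carrier (free_group S)"
  by (simp add: free_group_def)

lemma generator_in_free_group [simp]: "[(s, b)] \<in> carrier (free_group S) \<longleftrightarrow> s \<in> S"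
  by (simp add: free_group_def)

lemma inv_generator:
  assumes "s \<in> S"
  shows "inv\<^bsub>free_group S\<^esub> [(s, True)] = [(s, False)]"
proof -
  interpret group "free_group S" by (rule group_free_group)
  show ?thesis
    by (rule inv_equality) (use assms in \<open>auto simp: free_group_def letter_inv_def\<close>)
qed

text \<open>Prepending a letter to get a reduced word causes no cancellation, so the list is also
  the product in the free group. This turns list induction into induction along products of
  letters.\<close>

lemma Cons_in_free_group:
  assumes "a # w \<in> carrier (free_group S)"
  shows "[a] \<in> carrier (free_group S)" "w \<in> carrier (free_group S)"
    and "a # w = [a] \<otimes>\<^bsub>free_group S\<^esub> w"
  using assms by (auto simp: free_group_def dest: reduced_ConsD)
    (cases w; auto)+

text \<open>Uniqueness in the universal property: the values on inverse letters are forced by those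
  on the generators, and induction on reduced words does the rest.\<close>

lemma free_group_hom_eqI:
  assumes "group H" "f \<in> hom (free_group S) H" "f' \<in> hom (free_group S) H"
    and eq: "\<And>s. s \<in> S \<Longrightarrow> f [(s, True)] = f' [(s, True)]"
    and "w \<in> carrier (free_group S)"
  shows "f w = f' w"
proof -
  interpret f: group_hom "free_group S" H f
    using assms by (simp add: group_hom_def group_hom_axioms_def group_free_group)
  interpret f': group_hom "free_group S" H f'
    using assms by (simp add: group_hom_def group_hom_axioms_def group_free_group)
  show ?thesis
    using assms(5)
  proof (induction w)
    case Nil
    show ?case using f.hom_one f'.hom_one by (simp add: free_group_def)
  next
    case (Cons a w)
    note w = Cons_in_free_group[OF Cons.prems]
    obtain s b where a: "a = (s, b)" by (cases a)
    have s: "s \<in> S" using w(1) a by simp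
    have "f [(s, False)] = f' [(s, False)]"
      unfolding inv_generator[OF s, symmetric] using s eq by simp
    then have "f [a] = f' [a]" using a eq[OF s] by (cases b) auto
    then show ?case using w Cons.IH by (metis f.hom_mult f'.hom_mult)
  qed
qed

lemma word_value_generator:
  assumes "group G" "\<iota> s \<in> carrier G"
  shows "word_value G \<iota> [(s, True)] = \<iota> s"
proof -
  interpret group G by fact
  show ?thesis using assms by (simp add: word_value_Cons word_value_Nil)
qed

lemma group_hom_word_value:
  assumes "group G" "\<iota> \<in> S \<rightarrow> carrier G"
  shows "group_hom (free_group S) G (word_value G \<iota>)"
  using assms by (simp add: group_hom_def group_hom_axioms_def group_free_group word_value_hom)

text \<open>Tietze's argument: choosing words \<open>p s\<close> and \<open>q s'\<close> that express each generating system in terms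
  of the other, the kernel on \<open>S'\<close> is generated by the translated relators \<open>R\<close> together with
  \<open>s'\<^sup>-\<^sup>1 p(q s')\<close>, because modulo these every word \<open>w\<close> equals \<open>p(q w)\<close>.\<close>

lemma finite_presentation_transfer:
  assumes pres: "is_presentation G S \<iota> R" and fin: "finite R" "finite S'"
    and \<iota>': "\<iota>' \<in> S' \<rightarrow> carrier G"
    and gen: "word_value G \<iota>' ` carrier (free_group S') = carrier G"
  shows "\<exists>R'. finite R' \<and> is_presentation G S' \<iota>' R'"
proof -
  let ?F = "free_group S" and ?F' = "free_group S'"
  have G: "group G" and \<iota>: "\<iota> \<in> S \<rightarrow> carrier G" and R: "R \<subseteq> carrier ?F"
    and sur: "word_value G \<iota> ` carrier ?F = carrier G"
    and ker: "kernel ?F G (word_value G \<iota>) = normal_closure ?F R"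
    using pres by (auto simp: is_presentation_def)
  interpret v: group_hom ?F G "word_value G \<iota>" by (rule group_hom_word_value[OF G \<iota>])
  interpret v': group_hom ?F' G "word_value G \<iota>'" by (rule group_hom_word_value[OF G \<iota>'])
  have "\<forall>s\<in>S. \<exists>w\<in>carrier ?F'. word_value G \<iota>' w = \<iota> s"
    using \<iota> gen by (metis PiE imageE)
  then obtain p where p: "\<And>s. s \<in> S \<Longrightarrow> p s \<in> carrier ?F'"
      "\<And>s. s \<in> S \<Longrightarrow> word_value G \<iota>' (p s) = \<iota> s"
    by metis
  have "\<forall>s\<in>S'. \<exists>w\<in>carrier ?F. word_value G \<iota> w = \<iota>' s"
    using \<iota>' sur by (metis PiE imageE)
  then obtain q where q: "\<And>s. s \<in> S' \<Longrightarrow> q s \<in> carrier ?F"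
      "\<And>s. s \<in> S' \<Longrightarrow> word_value G \<iota> (q s) = \<iota>' s"
    by metis
  \<comment> \<open>Taking a free group as the target of \<open>word_value\<close> gives the
    homomorphism that substitutes words for generators. Both substitutions are compatible with
    evaluation in \<open>G\<close>, as \<open>vf\<close> and \<open>vg\<close> show.\<close>
  define f where "f = word_value ?F' p"
  define g where "g = word_value ?F q"
  interpret f: group_hom ?F ?F' f
    unfolding f_def using p by (intro group_hom_word_value group_free_group) auto
  interpret g: group_hom ?F' ?F g
    unfolding g_def using q by (intro group_hom_word_value group_free_group) auto
  have f_gen: "f [(s, True)] = p s" if "s \<in> S" for s
    unfolding f_def using that p by (intro word_value_generator group_free_group)
  have g_gen: "g [(s, True)] = q s" if "s \<in> S'" for s
    unfolding g_def using that q by (intro word_value_generator group_free_group)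
  have vf: "word_value G \<iota>' (f w) = word_value G \<iota> w" if "w \<in> carrier ?F" for w
  proof -
    have "(word_value G \<iota>' \<circ> f) w = word_value G \<iota> w"
    proof (rule free_group_hom_eqI[OF G _ v.homh _ that])
      show "word_value G \<iota>' \<circ> f \<in> hom ?F G"
        using f.homh v'.homh by (rule hom_compose)
      show "(word_value G \<iota>' \<circ> f) [(s, True)] = word_value G \<iota> [(s, True)]" if "s \<in> S" for s
        using that \<iota> p f_gen word_value_generator[OF G, of \<iota> s] by (auto simp: Pi_iff)
    qed
    then show ?thesis by simp
  qed
  have vg: "word_value G \<iota> (g w) = word_value G \<iota>' w" if "w \<in> carrier ?F'" for w
  proof -
    have "(word_value G \<iota> \<circ> g) w = word_value G \<iota>' w"
    proof (rule free_group_hom_eqI[OF G _ v'.homh _ that])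
      show "word_value G \<iota> \<circ> g \<in> hom ?F' G"
        using g.homh v.homh by (rule hom_compose)
      show "(word_value G \<iota> \<circ> g) [(s, True)] = word_value G \<iota>' [(s, True)]" if "s \<in> S'" for s
        using that \<iota>' q g_gen word_value_generator[OF G, of \<iota>' s] by (auto simp: Pi_iff)
    qed
    then show ?thesis by simp
  qed
  define T where "T = f ` R \<union> (\<lambda>s. inv\<^bsub>?F'\<^esub> [(s, True)] \<otimes>\<^bsub>?F'\<^esub> f (q s)) ` S'"
  have T: "T \<subseteq> kernel ?F' G (word_value G \<iota>')"
  proof -
    have "f r \<in> kernel ?F' G (word_value G \<iota>')" if "r \<in> R" for r
    proof -
      have "r \<in> kernel ?F G (word_value G \<iota>)"
        unfolding ker using that subset_normal_closure[of R ?F] by auto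
      then have "r \<in> carrier ?F" "word_value G \<iota> r = \<one>\<^bsub>G\<^esub>"
        by (auto simp: kernel_def)
      then show ?thesis
        using vf[of r] by (simp add: kernel_def)
    qed
    moreover have "inv\<^bsub>?F'\<^esub> [(s, True)] \<otimes>\<^bsub>?F'\<^esub> f (q s) \<in> kernel ?F' G (word_value G \<iota>')" if "s \<in> S'" for s
    proof -
      have "\<iota>' s \<in> carrier G" using \<iota>' that by auto
      then show ?thesis
        using that q(1)[OF that] q(2)[OF that] vf[of "q s"] word_value_generator[OF G, of \<iota>' s]
        by (simp add: kernel_def)
    qed
    ultimately show ?thesis by (auto simp: T_def)
  qed
  then have TF: "T \<subseteq> carrier ?F'" by (auto simp: kernel_def)
  let ?M = "normal_closure ?F' T"
  have M: "?M \<lhd> ?F'" by (rule v'.G.normal_normal_closure[OF TF])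
  interpret M: normal ?M ?F' by (rule M)
  have "kernel ?F' G (word_value G \<iota>') = ?M"
  proof
    show "?M \<subseteq> kernel ?F' G (word_value G \<iota>')"
      by (rule normal_closure_minimal[OF v'.normal_kernel T])
    show "kernel ?F' G (word_value G \<iota>') \<subseteq> ?M"
    proof
      fix w assume "w \<in> kernel ?F' G (word_value G \<iota>')"
      then have w: "w \<in> carrier ?F'" "word_value G \<iota>' w = \<one>\<^bsub>G\<^esub>" by (auto simp: kernel_def)
      have "g w \<in> normal_closure ?F R"
        unfolding ker[symmetric] using w vg[of w] by (simp add: kernel_def)
      moreover have "f ` R \<subseteq> ?M"
        using subset_normal_closure[of T ?F'] by (auto simp: T_def)
      ultimately have fg: "f (g w) \<in> ?M" using f.hom_normal_closure[OF M R] by blast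
      \<comment> \<open>Modulo \<open>?M\<close> the words \<open>w\<close> and
        \<open>f (g w)\<close> agree: both sides are homomorphisms from a free group into the
        quotient, so the generators suffice, and there the second family in \<open>T\<close>
        applies.\<close>
      have "?M #>\<^bsub>?F'\<^esub> w = ((\<lambda>a. ?M #>\<^bsub>?F'\<^esub> a) \<circ> (f \<circ> g)) w"
      proof (rule free_group_hom_eqI[OF M.factorgroup_is_group M.r_coset_hom_Mod _ _ w(1)])
        show "(\<lambda>a. ?M #>\<^bsub>?F'\<^esub> a) \<circ> (f \<circ> g) \<in> hom ?F' (?F' Mod ?M)"
          using hom_compose[OF hom_compose[OF g.homh f.homh] M.r_coset_hom_Mod] .
        fix s assume s: "s \<in> S'"
        have c: "inv\<^bsub>?F'\<^esub> [(s, True)] \<otimes>\<^bsub>?F'\<^esub> f (q s) \<in> ?M"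
          using s subset_normal_closure[of T ?F'] by (auto simp: T_def)
        \<comment> \<open>Conjugation moves the factor s^-1 from the left of \<open>f (q s)\<close>
          to its right, the form in which membership in a right coset is tested.\<close>
        have "[(s, True)] \<otimes>\<^bsub>?F'\<^esub> (inv\<^bsub>?F'\<^esub> [(s, True)] \<otimes>\<^bsub>?F'\<^esub> f (q s)) \<otimes>\<^bsub>?F'\<^esub> inv\<^bsub>?F'\<^esub> [(s, True)] \<in> ?M"
          using s by (intro M.inv_op_closed2[OF _ c]) simp
        moreover have "[(s, True)] \<otimes>\<^bsub>?F'\<^esub> (inv\<^bsub>?F'\<^esub> [(s, True)] \<otimes>\<^bsub>?F'\<^esub> f (q s)) = f (q s)"
          using s q v'.G.inv_solve_left by (simp add: v'.G.m_assoc[symmetric])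
        ultimately have "f (q s) \<otimes>\<^bsub>?F'\<^esub> inv\<^bsub>?F'\<^esub> [(s, True)] \<in> ?M" by simp
        then have "f (q s) \<in> ?M #>\<^bsub>?F'\<^esub> [(s, True)]"
          using s q by (simp add: M.rcos_module v'.G.is_group)
        then have "?M #>\<^bsub>?F'\<^esub> [(s, True)] = ?M #>\<^bsub>?F'\<^esub> f (q s)"
          using s q by (intro v'.G.repr_independence M.subgroup_axioms) auto
        then show "?M #>\<^bsub>?F'\<^esub> [(s, True)] = ((\<lambda>a. ?M #>\<^bsub>?F'\<^esub> a) \<circ> (f \<circ> g)) [(s, True)]"
          using g_gen s by simp
      qed
      also have "\<dots> = ?M"
        using fg by (simp add: M.rcos_const)
      finally show "w \<in> ?M"
        using v'.G.rcos_self[OF w(1) M.subgroup_axioms] by simp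
    qed
  qed
  then have "is_presentation G S' \<iota>' T"
    using G \<iota>' TF gen by (simp add: is_presentation_def)
  moreover have "finite T" using fin by (simp add: T_def)
  ultimately show ?thesis by blast
qed

text \<open>\<open>finitely_presented\<close> asks for natural numbers as generating symbols.
  Renaming the symbols injectively keeps the system generating, and the transfer lemma then supplies
  finitely many relators for it.\<close>

lemma finite_presentation_reindex:
  assumes pres: "is_presentation G S \<iota> R" "finite R" and fin: "finite S"
  shows "finitely_presented G"
proof -
  obtain e :: "'c \<Rightarrow> nat" where e: "inj_on e S"
    using finite_imp_inj_to_nat_seg[OF fin] by blast
  let ?\<iota> = "\<iota> \<circ> inv_into S e"
  have G: "group G" and \<iota>: "\<iota> \<in> S \<rightarrow> carrier G"
    and sur: "word_value G \<iota> ` carrier (free_group S) = carrier G"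
    using pres by (auto simp: is_presentation_def)
  interpret group G by fact
  have \<iota>': "?\<iota> \<in> e ` S \<rightarrow> carrier G" using \<iota> e by auto
  interpret v: group_hom "free_group (e ` S)" G "word_value G ?\<iota>"
    by (rule group_hom_word_value[OF G \<iota>'])
  have "carrier G \<subseteq> word_value G ?\<iota> ` carrier (free_group (e ` S))"
  proof
    fix x assume "x \<in> carrier G"
    then obtain w where w: "w \<in> carrier (free_group S)" "x = word_value G \<iota> w"
      using sur by auto
    \<comment> \<open>The renamed letter is multiplied onto the word \<open>u\<close> inside the
      free group, so no reducedness of a renamed word has to be checked.\<close>
    from w(1) have "word_value G \<iota> w \<in> word_value G ?\<iota> ` carrier (free_group (e ` S))"
    proof (induction w)
      case Nil
      show ?case by (intro image_eqI[of _ _ "[]"]) (simp_all add: word_value_Nil)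
    next
      case (Cons a w)
      note aw = Cons_in_free_group[OF Cons.prems]
      obtain s b where a: "a = (s, b)" by (cases a)
      have s: "s \<in> S" using aw(1) a by simp
      obtain u where u: "u \<in> carrier (free_group (e ` S))" "word_value G \<iota> w = word_value G ?\<iota> u"
        using Cons.IH[OF aw(2)] by (elim imageE)
      have es: "[(e s, b)] \<in> carrier (free_group (e ` S))" using s by simp
      have cs: "\<iota> s \<in> carrier G" using \<iota> s by auto
      have "word_value G ?\<iota> ([(e s, b)] \<otimes>\<^bsub>free_group (e ` S)\<^esub> u) = word_value G \<iota> (a # w)"
        using s e u(2) a cs v.hom_mult[OF es u(1)] by (simp add: word_value_Cons word_value_Nil)
      then show ?case using es u(1) by (metis v.G.m_closed imageI)
    qed
    then show "x \<in> word_value G ?\<iota> ` carrier (free_group (e ` S))" using w by simp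
  qed
  then have "word_value G ?\<iota> ` carrier (free_group (e ` S)) = carrier G"
    using v.hom_closed by auto
  from finite_presentation_transfer[OF pres _ \<iota>' this]
  obtain R' where "finite R'" "is_presentation G (e ` S) ?\<iota> R'" using fin by auto
  then show ?thesis
    unfolding finitely_presented_def using fin by (intro exI conjI) auto
qed

section \<open>Direct limits\<close>

locale directed_system =
  fixes I :: "nat set"
    and H :: "nat \<Rightarrow> ('b, 'm) monoid_scheme"
    and f :: "nat \<Rightarrow> nat \<Rightarrow> 'b \<Rightarrow> 'b"
  assumes grp: "i \<in> I \<Longrightarrow> group (H i)"
    and trans_hom: "i \<in> I \<Longrightarrow> j \<in> I \<Longrightarrow> i \<le> j \<Longrightarrow> f i j \<in> hom (H i) (H j)"
    and trans_refl: "i \<in> I \<Longrightarrow> x \<in> carrier (H i) \<Longrightarrow> f i i x = x"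
    and trans_comp: "i \<in> I \<Longrightarrow> j \<in> I \<Longrightarrow> k \<in> I \<Longrightarrow> i \<le> j \<Longrightarrow> j \<le> k \<Longrightarrow> x \<in> carrier (H i) \<Longrightarrow>
      f j k (f i j x) = f i k x"
begin

abbreviation \<kappa> where "\<kappa> \<equiv> direct_limit_map I H f"

abbreviation L where "L \<equiv> direct_limit I H f"

lemma trans_closed: "i \<in> I \<Longrightarrow> j \<in> I \<Longrightarrow> i \<le> j \<Longrightarrow> x \<in> carrier (H i) \<Longrightarrow> f i j x \<in> carrier (H j)"
  using trans_hom hom_in_carrier by metis

lemma max_in: "i \<in> I \<Longrightarrow> j \<in> I \<Longrightarrow> max i j \<in> I"
  by (simp add: max_def)

text \<open>An identification made at one stage survives at all later ones. Witnesses found at two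
  different stages can thus be moved to their maximum, which is again an index.\<close>

lemma trans_eq_mono:
  assumes "f i k x = f j k y" "k \<le> l" "i \<le> k" "j \<le> k" "i \<in> I" "j \<in> I" "k \<in> I" "l \<in> I"
    "x \<in> carrier (H i)" "y \<in> carrier (H j)"
  shows "f i l x = f j l y"
  using assms trans_comp by metis

lemma equiv_rel: "equiv (SIGMA i:I. carrier (H i)) (direct_limit_rel I H f)"
proof (rule equivI)
  show "direct_limit_rel I H f \<subseteq> (SIGMA i:I. carrier (H i)) \<times> (SIGMA i:I. carrier (H i))"
    by (auto simp: direct_limit_rel_def)
  show "refl_on (SIGMA i:I. carrier (H i)) (direct_limit_rel I H f)"
    by (auto simp: refl_on_def direct_limit_rel_def)
  show "sym (direct_limit_rel I H f)"
    by (force simp: sym_def direct_limit_rel_def)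
  show "trans (direct_limit_rel I H f)"
  proof (rule transI, clarify)
    fix i x j y k z
    assume "((i, x), (j, y)) \<in> direct_limit_rel I H f" "((j, y), (k, z)) \<in> direct_limit_rel I H f"
    then obtain m n where mem: "i \<in> I" "j \<in> I" "k \<in> I" "m \<in> I" "n \<in> I"
        "x \<in> carrier (H i)" "y \<in> carrier (H j)" "z \<in> carrier (H k)"
      and le: "i \<le> m" "j \<le> m" "j \<le> n" "k \<le> n"
      and eq: "f i m x = f j m y" "f j n y = f k n z"
      by (auto simp: direct_limit_rel_def)
    have "f i (max m n) x = f j (max m n) y"
      using mem le max_in by (intro trans_eq_mono[OF eq(1)]) auto
    moreover have "f j (max m n) y = f k (max m n) z"
      using mem le max_in by (intro trans_eq_mono[OF eq(2)]) auto
    ultimately show "((i, x), (k, z)) \<in> direct_limit_rel I H f"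
      using mem le max_in[of m n] unfolding direct_limit_rel_def
      by (auto intro!: bexI[of _ "max m n"])
  qed
qed

lemma direct_limit_map_eq_iff:
  assumes "i \<in> I" "j \<in> I" "x \<in> carrier (H i)" "y \<in> carrier (H j)"
  shows "\<kappa> i x = \<kappa> j y \<longleftrightarrow> (\<exists>k\<in>I. i \<le> k \<and> j \<le> k \<and> f i k x = f j k y)"
  unfolding direct_limit_map_def
  using assms eq_equiv_class_iff[OF equiv_rel, of "(i, x)" "(j, y)"]
  by (auto simp: direct_limit_rel_def)

text \<open>The product in the limit is a union over all pairs of representatives. It collapses to a
  single term because that term depends only on the two classes.\<close>

lemma direct_limit_mult:
  assumes mem: "i \<in> I" "j \<in> I" "x \<in> carrier (H i)" "y \<in> carrier (H j)"
  shows "\<kappa> i x \<otimes>\<^bsub>L\<^esub> \<kappa> j y =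
    \<kappa> (max i j) (f i (max i j) x \<otimes>\<^bsub>H (max i j)\<^esub> f j (max i j) y)"
proof -
  let ?r = "direct_limit_rel I H f"
  define h where "h = (\<lambda>(i, x) (j, y). \<kappa> (max i j) (f i (max i j) x \<otimes>\<^bsub>H (max i j)\<^esub> f j (max i j) y))"
  have "congruent2 ?r ?r h"
  proof (rule congruent2I', clarify)
    fix i x i' x' j y j' y'
    assume "((i, x), (i', x')) \<in> ?r" "((j, y), (j', y')) \<in> ?r"
    then obtain m n where mem: "i \<in> I" "i' \<in> I" "j \<in> I" "j' \<in> I" "m \<in> I" "n \<in> I"
        "x \<in> carrier (H i)" "x' \<in> carrier (H i')" "y \<in> carrier (H j)" "y' \<in> carrier (H j')"
      and le: "i \<le> m" "i' \<le> m" "j \<le> n" "j' \<le> n"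
      and eq: "f i m x = f i' m x'" "f j n y = f j' n y'"
      by (auto simp: direct_limit_rel_def)
    let ?k = "max m n"
    have k: "?k \<in> I" using mem max_in by simp
    \<comment> \<open>Transition maps are homomorphisms, so a product formed at
      \<open>max a b\<close> and pushed to the common stage equals the product of the pushed
      factors. There equivalent representatives have become equal.\<close>
    have push: "f (max a b) ?k (f a (max a b) u \<otimes>\<^bsub>H (max a b)\<^esub> f b (max a b) v)
        = f a ?k u \<otimes>\<^bsub>H ?k\<^esub> f b ?k v"
      if "a \<in> I" "b \<in> I" "a \<le> m" "b \<le> n" "u \<in> carrier (H a)" "v \<in> carrier (H b)" for a b u v
    proof -
      have "max a b \<in> I" "max a b \<le> ?k" "a \<le> max a b" "b \<le> max a b"
        using that max_in by auto
      then show ?thesis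
        using that k hom_mult[OF trans_hom[of "max a b" ?k]] trans_closed trans_comp by simp
    qed
    have "f i ?k x = f i' ?k x'"
      using mem le k by (intro trans_eq_mono[OF eq(1)]) auto
    moreover have "f j ?k y = f j' ?k y'"
      using mem le k by (intro trans_eq_mono[OF eq(2)]) auto
    moreover have "f a (max a b) u \<otimes>\<^bsub>H (max a b)\<^esub> f b (max a b) v \<in> carrier (H (max a b))"
      if "a \<in> I" "b \<in> I" "u \<in> carrier (H a)" "v \<in> carrier (H b)" for a b u v
      using that max_in[of a b] by (intro monoid.m_closed group.is_monoid grp trans_closed) auto
    ultimately show "h (i, x) (j, y) = h (i', x') (j', y')"
      using mem le k push[of i j x y] push[of i' j' x' y'] max_in[of i j] max_in[of i' j']
      unfolding h_def by (subst prod.case)+ (subst direct_limit_map_eq_iff; auto intro!: bexI[of _ ?k])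
  qed
  from UN_equiv_class2[OF equiv_rel equiv_rel this, of "(i, x)" "(j, y)"]
  show ?thesis using mem by (simp add: direct_limit_def direct_limit_map_def h_def case_prod_beta)
qed

lemma direct_limit_map_hom:
  assumes "i \<in> I"
  shows "\<kappa> i \<in> hom (H i) L"
proof (rule homI)
  fix x y assume xy: "x \<in> carrier (H i)" "y \<in> carrier (H i)"
  show "\<kappa> i x \<in> carrier L"
    using assms xy by (auto simp: direct_limit_def direct_limit_map_def intro!: quotientI)
  show "\<kappa> i (x \<otimes>\<^bsub>H i\<^esub> y) = \<kappa> i x \<otimes>\<^bsub>L\<^esub> \<kappa> i y"
    using assms xy by (simp add: direct_limit_mult trans_refl)
qed

text \<open>Elements that agree at stage \<open>j\<close> have the same class in the limit, with
  \<open>j\<close> itself as the witnessing stage.\<close>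

lemma direct_limit_map_inj_imp_trans_inj:
  assumes "inj_on (\<kappa> i) (carrier (H i))" "i \<in> I" "j \<in> I" "i \<le> j"
  shows "inj_on (f i j) (carrier (H i))"
proof (rule inj_onI)
  fix x y assume "x \<in> carrier (H i)" "y \<in> carrier (H i)" "f i j x = f i j y"
  then show "x = y"
    using assms direct_limit_map_eq_iff[of i i x y] by (auto dest: inj_onD)
qed

text \<open>Identifications happen at some later stage, where injectivity undoes them. A class
  represented at stage \<open>j\<close> is pushed to \<open>max i j\<close> and pulled back to
  \<open>i\<close> by surjectivity.\<close>

lemma direct_limit_map_iso:
  assumes bij: "\<And>j. j \<in> I \<Longrightarrow> i \<le> j \<Longrightarrow> bij_betw (f i j) (carrier (H i)) (carrier (H j))"
    and i: "i \<in> I"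
  shows "\<kappa> i \<in> iso (H i) L"
proof -
  have "inj_on (\<kappa> i) (carrier (H i))"
  proof (rule inj_onI)
    fix x y assume xy: "x \<in> carrier (H i)" "y \<in> carrier (H i)" "\<kappa> i x = \<kappa> i y"
    then obtain k where "k \<in> I" "i \<le> k" "f i k x = f i k y"
      using i direct_limit_map_eq_iff by auto
    then show "x = y" using bij xy by (auto simp: bij_betw_def dest: inj_onD)
  qed
  moreover have "carrier L \<subseteq> \<kappa> i ` carrier (H i)"
  proof
    fix c assume "c \<in> carrier L"
    then obtain j y where y: "j \<in> I" "y \<in> carrier (H j)" "c = \<kappa> j y"
      by (auto simp: direct_limit_def direct_limit_map_def elim!: quotientE)
    have "\<exists>x\<in>carrier (H i). f i (max i j) x = f j (max i j) y"
    proof -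
      have "f j (max i j) y \<in> carrier (H (max i j))"
        using y i max_in by (intro trans_closed) auto
      then show ?thesis
        using bij[of "max i j"] max_in[of i j] i y by (metis bij_betw_imp_surj_on imageE max.cobounded1)
    qed
    then obtain x where "x \<in> carrier (H i)" "f i (max i j) x = f j (max i j) y" by blast
    then have "\<kappa> i x = \<kappa> j y"
      using i y max_in[of i j] by (subst direct_limit_map_eq_iff) (auto intro!: bexI[of _ "max i j"])
    then show "c \<in> \<kappa> i ` carrier (H i)"
      using y \<open>x \<in> carrier (H i)\<close> by blast
  qed
  ultimately show ?thesis
    using direct_limit_map_hom[OF i] hom_carrier[OF direct_limit_map_hom[OF i]]
    by (auto simp: iso_def bij_betw_def)
qed

end

section \<open>Directed systems of quotients of one group\<close>

lemma (in group) normal_set_mult_rcos: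
  assumes "M \<lhd> G" "N \<lhd> G" "M \<subseteq> N" "x \<in> carrier G"
  shows "N <#> (M #> x) = N #> x"
proof -
  interpret M: normal M G by fact
  interpret N: normal N G by fact
  have "N <#> M = N"
  proof
    show "N <#> M \<subseteq> N" using assms(3) by (auto simp: set_mult_def)
    show "N \<subseteq> N <#> M"
    proof
      fix n assume n: "n \<in> N"
      then have "n = n \<otimes> \<one>" using N.subset by auto
      then show "n \<in> N <#> M" unfolding set_mult_def using n M.one_closed by blast
    qed
  qed
  then show ?thesis
    using assms(4) M.subset N.subset by (simp add: setmult_rcos_assoc)
qed

text \<open>Multiplying a coset by the larger subgroup \<open>M j\<close> enlarges
  \<open>M i #> x\<close> to \<open>M j #> x\<close>. All axioms then reduce to coset
  representatives.\<close>

lemma (in group) directed_system_quotients: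
  assumes normal: "\<And>i. i \<in> I \<Longrightarrow> M i \<lhd> G"
    and mono: "\<And>i j. i \<in> I \<Longrightarrow> j \<in> I \<Longrightarrow> i \<le> j \<Longrightarrow> M i \<subseteq> M j"
  shows "directed_system I (\<lambda>i. G Mod M i) (\<lambda>i j C. M j <#> C)"
proof (rule directed_system.intro)
  have step: "M j <#> (M i #> x) = M j #> x" if "i \<in> I" "j \<in> I" "i \<le> j" "x \<in> carrier G" for i j x
    using that by (intro normal_set_mult_rcos normal mono)
  have carrierE: "\<exists>x\<in>carrier G. C = M i #> x" if "C \<in> carrier (G Mod M i)" for i C
    using that by (auto simp: FactGroup_def RCOSETS_def)
  show "Group.group (G Mod M i)" if "i \<in> I" for i
    using normal[OF that] by (rule normal.factorgroup_is_group)
  show "(\<lambda>C. M j <#> C) \<in> hom (G Mod M i) (G Mod M j)" if ij: "i \<in> I" "j \<in> I" "i \<le> j" for i j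
  proof (rule homI)
    fix C D assume C: "C \<in> carrier (G Mod M i)" and D: "D \<in> carrier (G Mod M i)"
    obtain x where x: "x \<in> carrier G" "C = M i #> x" using carrierE[OF C] by blast
    obtain y where y: "y \<in> carrier G" "D = M i #> y" using carrierE[OF D] by blast
    show "M j <#> C \<in> carrier (G Mod M j)"
      using step[OF ij x(1)] x by (auto simp: FactGroup_def RCOSETS_def)
    have "C \<otimes>\<^bsub>G Mod M i\<^esub> D = M i #> (x \<otimes> y)"
      using x y normal.rcos_sum[OF normal[OF ij(1)]] by (simp add: FactGroup_def)
    then show "M j <#> (C \<otimes>\<^bsub>G Mod M i\<^esub> D) = (M j <#> C) \<otimes>\<^bsub>G Mod M j\<^esub> (M j <#> D)"
      using x y step[OF ij] normal.rcos_sum[OF normal[OF ij(2)]] by (simp add: FactGroup_def)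
  qed
  show "M i <#> C = C" if "i \<in> I" "C \<in> carrier (G Mod M i)" for i C
    using carrierE[OF that(2)] step[of i i] that(1) by auto
  show "M k <#> (M j <#> C) = M k <#> C"
    if "i \<in> I" "j \<in> I" "k \<in> I" "i \<le> j" "j \<le> k" "C \<in> carrier (G Mod M i)" for i j k C
    using carrierE[OF that(6)] step[of i j] step[of j k] step[of i k] that by auto
qed

section \<open>The groupoid of path classes\<close>

definition path_classes :: "'a::topological_space set \<Rightarrow> (real \<Rightarrow> 'a) set set"
  where "path_classes X = path_class X ` {\<gamma>. path \<gamma> \<and> path_image \<gamma> \<subseteq> X}"

text \<open>Homotopies here are relative to the end points, so the choice of representative does not
  matter.\<close>

definition class_start :: "(real \<Rightarrow> 'a::topological_space) set \<Rightarrow> 'a"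
  where "class_start A = pathstart (SOME \<gamma>. \<gamma> \<in> A)"

definition class_finish :: "(real \<Rightarrow> 'a::topological_space) set \<Rightarrow> 'a"
  where "class_finish A = pathfinish (SOME \<gamma>. \<gamma> \<in> A)"

definition class_const :: "'a::topological_space set \<Rightarrow> 'a \<Rightarrow> (real \<Rightarrow> 'a) set"
  where "class_const X x = path_class X (\<lambda>_. x)"

text \<open>The union over representatives repeats the multiplication in
  \<open>fundamental_group\<close>, so that the two operations coincide literally.\<close>

definition class_join ::
    "'a::topological_space set \<Rightarrow> (real \<Rightarrow> 'a) set \<Rightarrow> (real \<Rightarrow> 'a) set \<Rightarrow> (real \<Rightarrow> 'a) set"
  where "class_join X A B = (\<Union>\<gamma>\<in>A. \<Union>\<gamma>'\<in>B. path_class X (\<gamma> +++ \<gamma>'))"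

definition class_reverse ::
    "'a::topological_space set \<Rightarrow> (real \<Rightarrow> 'a) set \<Rightarrow> (real \<Rightarrow> 'a) set"
  where "class_reverse X A = (\<Union>\<gamma>\<in>A. path_class X (reversepath \<gamma>))"

definition class_map ::
    "'a::topological_space set \<Rightarrow> ('a \<Rightarrow> 'a) \<Rightarrow> (real \<Rightarrow> 'a) set \<Rightarrow> (real \<Rightarrow> 'a) set"
  where "class_map X h A = (\<Union>\<gamma>\<in>A. path_class X (h \<circ> \<gamma>))"

lemma path_class_eqI: "homotopic_paths X \<gamma> \<gamma>' \<Longrightarrow> path_class X \<gamma> = path_class X \<gamma>'"
  by (auto simp: path_class_def intro: homotopic_paths_trans homotopic_paths_sym)

lemma in_path_class: "path \<gamma> \<Longrightarrow> path_image \<gamma> \<subseteq> X \<Longrightarrow> \<gamma> \<in> path_class X \<gamma>"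
  by (simp add: path_class_def)

text \<open>Each operation on classes is a union over representatives of terms that do not depend on
  the representative. Such a union is any one of its terms.\<close>

lemma UN_path_class:
  assumes "path \<gamma>" "path_image \<gamma> \<subseteq> X"
    and "\<And>\<gamma>'. homotopic_paths X \<gamma> \<gamma>' \<Longrightarrow> f \<gamma>' = f \<gamma>"
  shows "(\<Union>\<gamma>'\<in>path_class X \<gamma>. f \<gamma>') = f \<gamma>"
  using assms(3) in_path_class[OF assms(1,2)] unfolding path_class_def by blast

lemma path_classesE:
  assumes "A \<in> path_classes X"
  obtains \<gamma> where "A = path_class X \<gamma>" "path \<gamma>" "path_image \<gamma> \<subseteq> X"
  using assms by (auto simp: path_classes_def)

lemma path_class_closed [simp]:
  "path \<gamma> \<Longrightarrow> path_image \<gamma> \<subseteq> X \<Longrightarrow> path_class X \<gamma> \<in> path_classes X"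
  by (simp add: path_classes_def)

lemma class_ends_path_class [simp]:
  assumes "path \<gamma>" "path_image \<gamma> \<subseteq> X"
  shows "class_start (path_class X \<gamma>) = pathstart \<gamma>" "class_finish (path_class X \<gamma>) = pathfinish \<gamma>"
proof -
  have "(SOME \<gamma>'. \<gamma>' \<in> path_class X \<gamma>) \<in> path_class X \<gamma>"
    using in_path_class[OF assms] by (metis someI)
  then have "homotopic_paths X \<gamma> (SOME \<gamma>'. \<gamma>' \<in> path_class X \<gamma>)"
    by (simp add: path_class_def)
  then show "class_start (path_class X \<gamma>) = pathstart \<gamma>" "class_finish (path_class X \<gamma>) = pathfinish \<gamma>"
    by (auto simp: class_start_def class_finish_def
        dest: homotopic_paths_imp_pathstart homotopic_paths_imp_pathfinish)
qed

lemma class_ends_in [simp]: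
  assumes "A \<in> path_classes X"
  shows "class_start A \<in> X" "class_finish A \<in> X"
  using assms by (auto elim!: path_classesE intro: subsetD[OF _ pathstart_in_path_image] subsetD[OF _ pathfinish_in_path_image])

lemma path_const [simp]: "path (\<lambda>_. x)"
  by (simp add: path_def)

lemma path_image_const [simp]: "path_image (\<lambda>_. x) = {x}"
  by (auto simp: path_image_def)

lemma class_const_ends [simp]:
  assumes "x \<in> X"
  shows "class_const X x \<in> path_classes X"
    "class_start (class_const X x) = x" "class_finish (class_const X x) = x"
  using assms by (simp_all add: class_const_def) (simp_all add: pathstart_def pathfinish_def)

lemma class_join_path_class:
  assumes "path \<gamma>" "path_image \<gamma> \<subseteq> X" "path \<delta>" "path_image \<delta> \<subseteq> X" "pathfinish \<gamma> = pathstart \<delta>"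
  shows "class_join X (path_class X \<gamma>) (path_class X \<delta>) = path_class X (\<gamma> +++ \<delta>)"
proof -
  have inner: "(\<Union>\<delta>'\<in>path_class X \<delta>. path_class X (\<gamma>' +++ \<delta>')) = path_class X (\<gamma> +++ \<delta>)"
    if \<gamma>': "homotopic_paths X \<gamma> \<gamma>'" for \<gamma>'
  proof -
    have "path_class X (\<gamma>' +++ \<delta>') = path_class X (\<gamma> +++ \<delta>)" if "homotopic_paths X \<delta> \<delta>'" for \<delta>'
      using \<gamma>' that assms(5)
      by (intro path_class_eqI homotopic_paths_sym[OF homotopic_paths_join])
    then show ?thesis using in_path_class[OF assms(3,4)] unfolding path_class_def[of X \<delta>] by blast
  qed
  have refl: "homotopic_paths X \<gamma> \<gamma>" using assms by simp
  show ?thesis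
    unfolding class_join_def inner[OF refl, symmetric]
    by (rule UN_path_class[OF assms(1,2)]) (simp only: inner[OF refl] inner)
qed

lemma class_reverse_path_class:
  assumes "path \<gamma>" "path_image \<gamma> \<subseteq> X"
  shows "class_reverse X (path_class X \<gamma>) = path_class X (reversepath \<gamma>)"
  unfolding class_reverse_def using assms
  by (intro UN_path_class path_class_eqI) (auto simp: homotopic_paths_reversepath intro: homotopic_paths_sym)

lemma class_map_path_class:
  assumes "path \<gamma>" "path_image \<gamma> \<subseteq> X" "continuous_on X h" "h \<in> X \<rightarrow> X"
  shows "class_map X h (path_class X \<gamma>) = path_class X (h \<circ> \<gamma>)"
  unfolding class_map_def using assms
  by (intro UN_path_class path_class_eqI) (auto intro: homotopic_paths_sym homotopic_paths_continuous_image)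

lemma path_compose:
  assumes "path \<gamma>" "path_image \<gamma> \<subseteq> X" "continuous_on X h" "h \<in> X \<rightarrow> X"
  shows "path (h \<circ> \<gamma>)" "path_image (h \<circ> \<gamma>) \<subseteq> X"
  using assms
  by (auto simp: path_image_compose intro: path_continuous_image continuous_on_subset)

lemma class_join_closed [simp]:
  assumes "A \<in> path_classes X" "B \<in> path_classes X" "class_finish A = class_start B"
  shows "class_join X A B \<in> path_classes X"
    "class_start (class_join X A B) = class_start A" "class_finish (class_join X A B) = class_finish B"
  using assms by (auto elim!: path_classesE simp: class_join_path_class subset_path_image_join)

lemma class_reverse_closed [simp]:
  assumes "A \<in> path_classes X"
  shows "class_reverse X A \<in> path_classes X"
    "class_start (class_reverse X A) = class_finish A" "class_finish (class_reverse X A) = class_start A"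
  using assms by (auto elim!: path_classesE simp: class_reverse_path_class)

lemma class_map_closed [simp]:
  assumes "A \<in> path_classes X" "continuous_on X h" "h \<in> X \<rightarrow> X"
  shows "class_map X h A \<in> path_classes X"
    "class_start (class_map X h A) = h (class_start A)"
    "class_finish (class_map X h A) = h (class_finish A)"
  using assms
  by (auto elim!: path_classesE simp: class_map_path_class path_compose pathstart_compose pathfinish_compose)

lemma class_join_assoc [simp]:
  assumes "A \<in> path_classes X" "B \<in> path_classes X" "C \<in> path_classes X"
    "class_finish A = class_start B" "class_finish B = class_start C"
  shows "class_join X (class_join X A B) C = class_join X A (class_join X B C)"
proof -
  obtain \<alpha> \<beta> \<gamma> where
    "A = path_class X \<alpha>" "path \<alpha>" "path_image \<alpha> \<subseteq> X"
    "B = path_class X \<beta>" "path \<beta>" "path_image \<beta> \<subseteq> X"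
    "C = path_class X \<gamma>" "path \<gamma>" "path_image \<gamma> \<subseteq> X"
    using assms(1-3) by (meson path_classesE)
  moreover from this assms(4,5) have "path_class X (\<alpha> +++ (\<beta> +++ \<gamma>)) = path_class X ((\<alpha> +++ \<beta>) +++ \<gamma>)"
    by (intro path_class_eqI homotopic_paths_assoc) simp_all
  ultimately show ?thesis
    using assms(4,5) by (simp add: class_join_path_class subset_path_image_join)
qed

text \<open>The library proves the following three facts only for paths in normed spaces, where constant paths
  are degenerate line segments.\<close>

lemma homotopic_paths_join_const:
  assumes "path \<gamma>" "path_image \<gamma> \<subseteq> X"
  shows "homotopic_paths X (\<gamma> +++ (\<lambda>_. pathfinish \<gamma>)) \<gamma>"
proof -
  \<comment> \<open>The reparametrisation traverses the path in the first half of the interval and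
    rests at its end in the second.\<close>
  have "continuous_on {0..1} (\<lambda>t::real. min (2 * t) 1)"
    by (intro continuous_intros)
  then show ?thesis
    using assms
    by (intro homotopic_paths_sym[OF homotopic_paths_reparametrize[where f = "\<lambda>t. min (2 * t) 1"]])
      (auto simp: joinpaths_def pathfinish_def min_def)
qed

lemma homotopic_paths_const_join:
  assumes "path \<gamma>" "path_image \<gamma> \<subseteq> X"
  shows "homotopic_paths X ((\<lambda>_. pathstart \<gamma>) +++ \<gamma>) \<gamma>"
proof -
  \<comment> \<open>Now the rest comes first: the path is traversed only in the second half.\<close>
  have "continuous_on {0..1} (\<lambda>t::real. max (2 * t - 1) 0)"
    by (intro continuous_intros)
  then show ?thesis
    using assms
    by (intro homotopic_paths_sym[OF homotopic_paths_reparametrize[where f = "\<lambda>t. max (2 * t - 1) 0"]])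
      (auto simp: joinpaths_def pathstart_def max_def)
qed

lemma homotopic_paths_join_reversepath:
  assumes "path \<gamma>" "path_image \<gamma> \<subseteq> X"
  shows "homotopic_paths X (\<gamma> +++ reversepath \<gamma>) (\<lambda>_. pathstart \<gamma>)"
proof (rule homotopic_paths_sym)
  \<comment> \<open>At homotopy time \<open>fst y\<close> the path is followed out to that parameter
    and back again. Time 0 gives the constant path, time 1 the full path followed by its
    reverse.\<close>
  let ?g = "\<lambda>y::real \<times> real. fst y * min (2 * snd y) (2 - 2 * snd y)"
  let ?h = "\<lambda>y. \<gamma> (?g y)"
  have g: "?g y \<in> {0..1}" if "y \<in> {0..1} \<times> {0..1}" for y
    using that by (auto simp: min_def mult_le_one)
  have "continuous_on ({0..1} \<times> {0..1}) ?g"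
    by (intro continuous_intros)
  moreover have "continuous_on {0..1} \<gamma>" using assms by (simp add: path_def)
  ultimately have "continuous_on ({0..1} \<times> {0..1}) ?h"
    using g by (intro continuous_on_compose2[of "{0..1}" \<gamma> _ ?g]) auto
  moreover have "?h \<in> {0..1} \<times> {0..1} \<rightarrow> X"
    using g assms(2) unfolding path_image_def by blast
  moreover have "?h (1, t) = (\<gamma> +++ reversepath \<gamma>) t" for t
    by (auto simp: joinpaths_def reversepath_def min_def algebra_simps)
  ultimately show "homotopic_paths X (\<lambda>_. pathstart \<gamma>) (\<gamma> +++ reversepath \<gamma>)"
    unfolding homotopic_paths
    by (intro exI[of _ ?h]) (simp add: pathstart_def pathfinish_def)
qed

lemma class_join_const [simp]:
  assumes "A \<in> path_classes X"
  shows "class_start A = x \<Longrightarrow> class_join X (class_const X x) A = A"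
    "class_finish A = x \<Longrightarrow> class_join X A (class_const X x) = A"
proof -
  obtain \<gamma> where A: "A = path_class X \<gamma>" "path \<gamma>" "path_image \<gamma> \<subseteq> X"
    using assms by (rule path_classesE)
  have in_X: "class_start A \<in> X" "class_finish A \<in> X" using assms by simp_all
  have const: "pathstart (\<lambda>_. x) = x" "pathfinish (\<lambda>_. x) = x"
    by (simp_all add: pathstart_def pathfinish_def)
  show "class_join X (class_const X x) A = A" if "class_start A = x"
    using A that in_X const path_class_eqI[OF homotopic_paths_const_join[OF A(2,3)]]
    by (simp add: class_const_def class_join_path_class)
  show "class_join X A (class_const X x) = A" if "class_finish A = x"
    using A that in_X const path_class_eqI[OF homotopic_paths_join_const[OF A(2,3)]]
    by (simp add: class_const_def class_join_path_class)
qed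

lemma class_join_reverse [simp]:
  assumes "A \<in> path_classes X"
  shows "class_join X A (class_reverse X A) = class_const X (class_start A)"
    "class_join X (class_reverse X A) A = class_const X (class_finish A)"
proof -
  obtain \<gamma> where A: "A = path_class X \<gamma>" "path \<gamma>" "path_image \<gamma> \<subseteq> X"
    using assms by (rule path_classesE)
  show "class_join X A (class_reverse X A) = class_const X (class_start A)"
    using A path_class_eqI[OF homotopic_paths_join_reversepath[of \<gamma> X]]
    by (simp add: class_const_def class_join_path_class class_reverse_path_class)
  show "class_join X (class_reverse X A) A = class_const X (class_finish A)"
    using A path_class_eqI[OF homotopic_paths_join_reversepath[of "reversepath \<gamma>" X]]
    by (simp add: class_const_def class_join_path_class class_reverse_path_class)
qed

text \<open>Once products are associated to the right, a class and its reverse are adjacent only in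
  front of a remaining factor. These variants let simplification cancel them there.\<close>

lemma class_join_cancel [simp]:
  assumes "A \<in> path_classes X" "B \<in> path_classes X"
  shows "class_start A = class_start B \<Longrightarrow> class_join X A (class_join X (class_reverse X A) B) = B"
    "class_finish A = class_start B \<Longrightarrow> class_join X (class_reverse X A) (class_join X A B) = B"
  using assms by (simp_all flip: class_join_assoc)

lemma class_reverse_reverse [simp]:
  "A \<in> path_classes X \<Longrightarrow> class_reverse X (class_reverse X A) = A"
  by (auto elim!: path_classesE simp: class_reverse_path_class)

lemma class_reverse_const [simp]:
  "x \<in> X \<Longrightarrow> class_reverse X (class_const X x) = class_const X x"
  by (simp add: class_const_def class_reverse_path_class) (simp add: reversepath_def)

lemma class_reverse_join [simp]:
  assumes "A \<in> path_classes X" "B \<in> path_classes X" "class_finish A = class_start B"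
  shows "class_reverse X (class_join X A B) = class_join X (class_reverse X B) (class_reverse X A)"
  using assms
  by (auto elim!: path_classesE simp: class_join_path_class class_reverse_path_class
      subset_path_image_join reversepath_joinpaths)

lemma class_map_join [simp]:
  assumes "A \<in> path_classes X" "B \<in> path_classes X" "class_finish A = class_start B"
    "continuous_on X h" "h \<in> X \<rightarrow> X"
  shows "class_map X h (class_join X A B) = class_join X (class_map X h A) (class_map X h B)"
  using assms
  by (auto elim!: path_classesE simp: class_join_path_class class_map_path_class path_compose
      subset_path_image_join pathstart_compose pathfinish_compose path_compose_join)

lemma class_map_reverse [simp]:
  assumes "A \<in> path_classes X" "continuous_on X h" "h \<in> X \<rightarrow> X"
  shows "class_map X h (class_reverse X A) = class_reverse X (class_map X h A)"
  using assms
  by (auto elim!: path_classesE simp: class_map_path_class path_compose class_reverse_path_class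
      path_compose_reversepath)

lemma class_map_const [simp]:
  assumes "x \<in> X" "continuous_on X h" "h \<in> X \<rightarrow> X"
  shows "class_map X h (class_const X x) = class_const X (h x)"
  using assms by (simp add: class_const_def class_map_path_class o_def)

lemma class_map_class_map:
  assumes "A \<in> path_classes X" "continuous_on X h" "h \<in> X \<rightarrow> X" "continuous_on X k" "k \<in> X \<rightarrow> X"
  shows "class_map X k (class_map X h A) = class_map X (k \<circ> h) A"
proof -
  have "continuous_on X (k \<circ> h)" "k \<circ> h \<in> X \<rightarrow> X"
    using assms(2-5) continuous_on_subset[of X k "h ` X"]
    by (auto simp del: o_apply intro: continuous_on_compose) auto
  then show ?thesis
    using assms by (auto elim!: path_classesE simp: class_map_path_class path_compose comp_assoc)
qed

text \<open>Paths that agree pointwise are homotopic. This form is needed because the laws of an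
  action hold only at points of \<open>X\<close>.\<close>

lemma class_map_cong:
  assumes "A \<in> path_classes X" "continuous_on X h" "h \<in> X \<rightarrow> X" "\<And>x. x \<in> X \<Longrightarrow> h x = k x"
  shows "class_map X h A = class_map X k A"
proof -
  obtain \<gamma> where A: "A = path_class X \<gamma>" "path \<gamma>" "path_image \<gamma> \<subseteq> X"
    using assms(1) by (rule path_classesE)
  have k: "continuous_on X k" "k \<in> X \<rightarrow> X"
    using assms(2-4) by (auto simp: Pi_iff cong: continuous_on_cong)
  have "homotopic_paths X (h \<circ> \<gamma>) (k \<circ> \<gamma>)"
    using A assms path_compose[OF A(2,3) assms(2,3)]
    by (intro homotopic_paths_eq) (auto simp: path_image_def image_subset_iff)
  then show ?thesis
    using A assms k by (auto simp: class_map_path_class dest: path_class_eqI)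
qed

lemma class_map_id:
  assumes "A \<in> path_classes X" "\<And>x. x \<in> X \<Longrightarrow> h x = x"
  shows "class_map X h A = A"
proof -
  have "class_map X h A = class_map X id A"
    using assms by (intro class_map_cong[symmetric]) auto
  also have "\<dots> = A"
    using assms(1) by (auto elim!: path_classesE simp: class_map_path_class)
  finally show ?thesis .
qed

text \<open>The fundamental group is the vertex group of the groupoid at \<open>x\<close>, so the
  groupoid rules decide identities in it.\<close>

lemma fundamental_group_simps:
  "carrier (fundamental_group X x) = {A \<in> path_classes X. class_start A = x \<and> class_finish A = x}"
  "mult (fundamental_group X x) = class_join X"
  "one (fundamental_group X x) = class_const X x"
proof -
  have "path_class X ` {\<gamma>. path_in X x x \<gamma>} = {A \<in> path_classes X. class_start A = x \<and> class_finish A = x}"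
    by (auto simp: path_in_def elim!: path_classesE)
  then show "carrier (fundamental_group X x) = {A \<in> path_classes X. class_start A = x \<and> class_finish A = x}"
    by (simp add: fundamental_group_def)
qed (auto simp: fundamental_group_def class_join_def class_const_def fun_eq_iff)

lemma group_fundamental_group:
  assumes "x \<in> X"
  shows "group (fundamental_group X x)"
proof (rule groupI)
  fix A assume "A \<in> carrier (fundamental_group X x)"
  then show "\<exists>B\<in>carrier (fundamental_group X x). B \<otimes>\<^bsub>fundamental_group X x\<^esub> A = \<one>\<^bsub>fundamental_group X x\<^esub>"
    by (intro bexI[of _ "class_reverse X A"]) (auto simp: fundamental_group_simps)
qed (use assms in \<open>auto simp: fundamental_group_simps\<close>)

section \<open>Semidirect products\<close>

lemma group_semidirect_product:
  assumes N: "group N" and H: "group H"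
    and hom: "\<And>h. h \<in> carrier H \<Longrightarrow> \<phi> h \<in> hom N N"
    and mult: "\<And>h k n. h \<in> carrier H \<Longrightarrow> k \<in> carrier H \<Longrightarrow> n \<in> carrier N \<Longrightarrow>
      \<phi> (h \<otimes>\<^bsub>H\<^esub> k) n = \<phi> h (\<phi> k n)"
    and one: "\<And>n. n \<in> carrier N \<Longrightarrow> \<phi> \<one>\<^bsub>H\<^esub> n = n"
  shows "group (semidirect_product N \<phi> H)"
proof -
  interpret N: group N by fact
  interpret H: group H by fact
  have closed: "\<phi> h n \<in> carrier N" if "h \<in> carrier H" "n \<in> carrier N" for h n
    using hom that hom_in_carrier by metis
  have phi_one: "\<phi> h \<one>\<^bsub>N\<^esub> = \<one>\<^bsub>N\<^esub>" if "h \<in> carrier H" for h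
    using hom_one[OF hom[OF that] N N] .
  show ?thesis
  proof (rule groupI)
    fix x assume "x \<in> carrier (semidirect_product N \<phi> H)"
    then obtain n h where x: "x = (n, h)" "n \<in> carrier N" "h \<in> carrier H"
      by (auto simp: semidirect_product_def)
    \<comment> \<open>The left inverse: its second component must be the inverse of
      \<open>h\<close>, and its first must cancel the image of \<open>n\<close> under that
      inverse.\<close>
    let ?y = "(\<phi> (inv\<^bsub>H\<^esub> h) (inv\<^bsub>N\<^esub> n), inv\<^bsub>H\<^esub> h)"
    have "\<phi> (inv\<^bsub>H\<^esub> h) (inv\<^bsub>N\<^esub> n) \<otimes>\<^bsub>N\<^esub> \<phi> (inv\<^bsub>H\<^esub> h) n = \<one>\<^bsub>N\<^esub>"
      using x hom_mult[OF hom, of "inv\<^bsub>H\<^esub> h" "inv\<^bsub>N\<^esub> n" n] phi_one by simp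
    then have "?y \<in> carrier (semidirect_product N \<phi> H)"
      "?y \<otimes>\<^bsub>semidirect_product N \<phi> H\<^esub> x = \<one>\<^bsub>semidirect_product N \<phi> H\<^esub>"
      using x closed by (simp_all add: semidirect_product_def)
    then show "\<exists>y\<in>carrier (semidirect_product N \<phi> H).
        y \<otimes>\<^bsub>semidirect_product N \<phi> H\<^esub> x = \<one>\<^bsub>semidirect_product N \<phi> H\<^esub>" by blast
  qed (auto simp: semidirect_product_def closed one mult N.m_assoc H.m_assoc hom_mult[OF hom])
qed

section \<open>The ambient group of a free action\<close>

locale jumping_data =
  fixes X :: "'a::topological_space set" and S :: "'s set"
    and \<rho> :: "'s letter list \<Rightarrow> 'a \<Rightarrow> 'a" and x\<^sub>0 :: 'a and \<alpha> :: "'s \<Rightarrow> real \<Rightarrow> 'a"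
  assumes action: "action_by_homeomorphisms (free_group S) X \<rho>"
    and base: "x\<^sub>0 \<in> X"
    and generator_path: "s \<in> S \<Longrightarrow> path_in X x\<^sub>0 (\<rho> [(s, True)] x\<^sub>0) (\<alpha> s)"
begin

abbreviation F where "F \<equiv> free_group S"

abbreviation N where "N \<equiv> fundamental_group X x\<^sub>0"

abbreviation \<phi> where "\<phi> \<equiv> word_automorphism X \<rho> x\<^sub>0 \<alpha>"

abbreviation W where "W \<equiv> ambient_group X S \<rho> x\<^sub>0 \<alpha>"

abbreviation join (infixr \<open>\<star>\<close> 70) where "A \<star> B \<equiv> class_join X A B"

abbreviation rev_class where "rev_class \<equiv> class_reverse X"

abbreviation move where "move w \<equiv> class_map X (\<rho> w)"

abbreviation word_class where "word_class w \<equiv> path_class X (word_path \<rho> x\<^sub>0 \<alpha> w)"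

abbreviation letter_class where "letter_class l \<equiv> path_class X (letter_path \<rho> \<alpha> l)"

sublocale F: group F by (rule group_free_group)

sublocale act: group_action F X \<rho>
  using action by (simp add: action_by_homeomorphisms_def)

lemma continuous_act [simp]: "w \<in> carrier F \<Longrightarrow> continuous_on X (\<rho> w)"
  using action by (auto simp: action_by_homeomorphisms_def homeomorphism_def)

lemma act_closed [simp]: "w \<in> carrier F \<Longrightarrow> x \<in> X \<Longrightarrow> \<rho> w x \<in> X"
  by (rule act.element_image) auto

lemma act_funcset [simp]: "w \<in> carrier F \<Longrightarrow> \<rho> w \<in> X \<rightarrow> X"
  by auto

lemma act_mult [simp]:
  "u \<in> carrier F \<Longrightarrow> v \<in> carrier F \<Longrightarrow> x \<in> X \<Longrightarrow> \<rho> (u \<otimes>\<^bsub>F\<^esub> v) x = \<rho> u (\<rho> v x)"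
  by (rule act.composition_rule)

lemma act_one [simp]: "x \<in> X \<Longrightarrow> \<rho> \<one>\<^bsub>F\<^esub> x = x"
  by (metis act.id_eq_one restrict_apply')

lemma move_mult [simp]:
  "u \<in> carrier F \<Longrightarrow> v \<in> carrier F \<Longrightarrow> A \<in> path_classes X \<Longrightarrow>
    move (u \<otimes>\<^bsub>F\<^esub> v) A = move u (move v A)"
  by (subst class_map_class_map) (simp_all, rule class_map_cong[OF _ continuous_act act_funcset], simp_all)

lemma move_one [simp]: "A \<in> path_classes X \<Longrightarrow> move \<one>\<^bsub>F\<^esub> A = A"
  by (intro class_map_id) simp_all

lemma one_F: "\<one>\<^bsub>F\<^esub> = []"
  by (simp add: free_group_def)

lemma letter_inverse:
  assumes "[l] \<in> carrier F"
  shows "[letter_inv l] \<in> carrier F" "[l] \<otimes>\<^bsub>F\<^esub> [letter_inv l] = \<one>\<^bsub>F\<^esub>"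
  using assms by (auto simp: free_group_def letter_inv_def)

lemma generator_class [simp]:
  assumes "s \<in> S"
  shows "path_class X (\<alpha> s) \<in> path_classes X"
    "class_start (path_class X (\<alpha> s)) = x\<^sub>0" "class_finish (path_class X (\<alpha> s)) = \<rho> [(s, True)] x\<^sub>0"
  using generator_path[OF assms] by (auto simp: path_in_def)

section \<open>The cocycle of path classes alpha_w\<close>

lemma letter_path_props:
  assumes "[l] \<in> carrier F"
  shows "path (letter_path \<rho> \<alpha> l)" "path_image (letter_path \<rho> \<alpha> l) \<subseteq> X"
    "pathstart (letter_path \<rho> \<alpha> l) = x\<^sub>0" "pathfinish (letter_path \<rho> \<alpha> l) = \<rho> [l] x\<^sub>0"
proof -
  obtain s b where l: "l = (s, b)" by (cases l)
  then have s: "s \<in> S" using assms by simp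
  note p = generator_path[OF s, unfolded path_in_def]
  \<comment> \<open>The path of an inverse letter starts at s^-1(s x_0), so this computation puts
    its start at the base point.\<close>
  have "\<rho> [(s, False)] (\<rho> [(s, True)] x\<^sub>0) = \<rho> ([(s, False)] \<otimes>\<^bsub>F\<^esub> [(s, True)]) x\<^sub>0"
    using s base by simp
  also have "\<dots> = x\<^sub>0"
    using s base F.l_inv[of "[(s, True)]"] by (simp add: inv_generator)
  finally have "\<rho> [(s, False)] (\<rho> [(s, True)] x\<^sub>0) = x\<^sub>0" .
  then show "path (letter_path \<rho> \<alpha> l)" "path_image (letter_path \<rho> \<alpha> l) \<subseteq> X"
    "pathstart (letter_path \<rho> \<alpha> l) = x\<^sub>0" "pathfinish (letter_path \<rho> \<alpha> l) = \<rho> [l] x\<^sub>0"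
    using p s l path_compose[of "reversepath (\<alpha> s)" X "\<rho> [(s, False)]"]
    by (auto simp: letter_path_def pathstart_compose pathfinish_compose)
qed

text \<open>The convention for alpha at an inverse letter is made for this identity: it lets alpha
  respect the cancellation of adjacent inverse letters.\<close>

lemma letter_class_inverse:
  assumes "[l] \<in> carrier F"
  shows "move [l] (letter_class (letter_inv l)) = rev_class (letter_class l)"
proof -
  obtain s b where l: "l = (s, b)" by (cases l)
  then have s: "s \<in> S" using assms by simp
  note p = generator_path[OF s, unfolded path_in_def]
  have neg: "letter_class (s, False) = move [(s, False)] (rev_class (path_class X (\<alpha> s)))"
    using p s by (simp add: letter_path_def class_reverse_path_class class_map_path_class)
  have pos: "letter_class (s, True) = path_class X (\<alpha> s)"
    by (simp add: letter_path_def)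
  show ?thesis
  proof (cases b)
    case True
    have "move [(s, True)] (move [(s, False)] A) = A" if "A \<in> path_classes X" for A
      using that s letter_inverse[of "(s, True)"] by (simp add: letter_inv_def flip: move_mult)
    then show ?thesis using True l s by (simp add: letter_inv_def neg pos)
  next
    case False
    then show ?thesis using l s by (simp add: letter_inv_def neg pos)
  qed
qed

lemma act_Cons:
  assumes "l # w \<in> carrier F" "x \<in> X"
  shows "\<rho> (l # w) x = \<rho> [l] (\<rho> w x)"
  using Cons_in_free_group[OF assms(1)] assms(2) by simp

lemma word_path_props:
  "w \<in> carrier F \<Longrightarrow> path (word_path \<rho> x\<^sub>0 \<alpha> w) \<and> path_image (word_path \<rho> x\<^sub>0 \<alpha> w) \<subseteq> X \<and>
    pathstart (word_path \<rho> x\<^sub>0 \<alpha> w) = x\<^sub>0 \<and> pathfinish (word_path \<rho> x\<^sub>0 \<alpha> w) = \<rho> w x\<^sub>0"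
proof (induction w)
  case Nil
  show ?case using base act_one[OF base] by (simp add: pathstart_def pathfinish_def one_F)
next
  case (Cons l w)
  note lw = Cons_in_free_group[OF Cons.prems]
  show ?case
    using Cons.IH[OF lw(2)] letter_path_props[OF lw(1)] lw(1,2) base act_Cons[OF Cons.prems base]
      path_compose[of "word_path \<rho> x\<^sub>0 \<alpha> w" X "\<rho> [l]"]
    by (simp add: subset_path_image_join pathstart_compose pathfinish_compose)
qed

lemma word_class [simp]:
  assumes "w \<in> carrier F"
  shows "word_class w \<in> path_classes X" "class_start (word_class w) = x\<^sub>0" "class_finish (word_class w) = \<rho> w x\<^sub>0"
  using word_path_props[OF assms] by simp_all

lemma letter_class_props [simp]:
  assumes "[l] \<in> carrier F"
  shows "letter_class l \<in> path_classes X"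
    "class_start (letter_class l) = x\<^sub>0" "class_finish (letter_class l) = \<rho> [l] x\<^sub>0"
  using letter_path_props[OF assms] by simp_all

lemma word_class_Cons:
  assumes "l # w \<in> carrier F"
  shows "word_class (l # w) = letter_class l \<star> move [l] (word_class w)"
proof -
  note lw = Cons_in_free_group[OF assms]
  show ?thesis
    using word_path_props[OF lw(2)] letter_path_props[OF lw(1)] lw(1,2)
      path_compose[of "word_path \<rho> x\<^sub>0 \<alpha> w" X "\<rho> [l]"]
    by (simp add: class_map_path_class class_join_path_class pathstart_compose)
qed

text \<open>If \<open>w\<close> starts with the inverse of \<open>l\<close>, followed by
  \<open>v\<close>, then alpha_l l(alpha_w) begins with alpha_l l(alpha_{l^-1}), which is
  null-homotopic, and alpha_v remains. Otherwise the product is the list with \<open>l\<close>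
  prepended.\<close>

lemma word_class_cancel_cons:
  assumes "[l] \<in> carrier F" "w \<in> carrier F"
  shows "word_class ([l] \<otimes>\<^bsub>F\<^esub> w) = letter_class l \<star> move [l] (word_class w)"
proof (cases w)
  case Nil
  have "[l] \<otimes>\<^bsub>F\<^esub> w = [l]" using Nil by (simp add: free_group_def)
  then show ?thesis using word_class_Cons[of l "[]"] assms Nil by (metis (no_types))
next
  case (Cons l' v)
  show ?thesis
  proof (cases "l' = letter_inv l")
    case True
    have v: "v \<in> carrier F" using assms Cons_in_free_group(2) Cons by blast
    note i = letter_inverse[OF assms(1)]
    have cancel: "\<rho> [l] (\<rho> [letter_inv l] x) = x" if "x \<in> X" for x
      using that assms i by (simp flip: act_mult)
    have "move [l] (move [letter_inv l] (word_class v)) = word_class v"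
      using assms i v by (simp flip: move_mult)
    moreover have "[l] \<otimes>\<^bsub>F\<^esub> w = v" using True Cons by (simp add: free_group_def)
    moreover have "word_class w = letter_class (letter_inv l) \<star> move [letter_inv l] (word_class v)"
      using word_class_Cons[of l' v] assms Cons True by simp
    ultimately show ?thesis
      using assms i v base letter_class_inverse[OF assms(1)] cancel by simp
  next
    case False
    have "[l] \<otimes>\<^bsub>F\<^esub> w = l # w" using False Cons by (simp add: free_group_def)
    then show ?thesis using assms F.m_closed[OF assms] by (simp add: word_class_Cons del: word_path.simps)
  qed
qed

text \<open>The cocycle identity alpha_{uv} = alpha_u u(alpha_v), by induction on the letters of
  \<open>u\<close>. The group law of \<open>W\<close> and all properties of \<open>\<sigma>\<close>
  below rest on it.\<close>

lemma word_class_mult: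
  "u \<in> carrier F \<Longrightarrow> v \<in> carrier F \<Longrightarrow> word_class (u \<otimes>\<^bsub>F\<^esub> v) = word_class u \<star> move u (word_class v)"
proof (induction u)
  case Nil
  have "[] \<otimes>\<^bsub>F\<^esub> v = v" by (simp add: free_group_def)
  moreover have "word_class v = word_class [] \<star> move [] (word_class v)"
    using Nil base move_one[of "word_class v"] act_one[of x\<^sub>0]
    by (simp add: one_F class_const_def[symmetric])
  ultimately show ?case by metis
next
  case (Cons l u)
  note lu = Cons_in_free_group[OF Cons.prems(1)]
  have "word_class ((l # u) \<otimes>\<^bsub>F\<^esub> v) = word_class ([l] \<otimes>\<^bsub>F\<^esub> (u \<otimes>\<^bsub>F\<^esub> v))"
    using lu Cons.prems by (simp add: F.m_assoc)
  then show ?case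
    using Cons.IH[OF lu(2)] lu Cons.prems(2) word_class_Cons[OF Cons.prems(1)] base
      word_class_cancel_cons[of l "u \<otimes>\<^bsub>F\<^esub> v"]
    by simp
qed

lemma word_class_one: "word_class \<one>\<^bsub>F\<^esub> = class_const X x\<^sub>0"
  by (simp add: one_F class_const_def)

lemma carrier_N [simp]: "A \<in> carrier N \<longleftrightarrow> A \<in> path_classes X \<and> class_start A = x\<^sub>0 \<and> class_finish A = x\<^sub>0"
  by (simp add: fundamental_group_simps)

lemma word_automorphism_eq:
  assumes "w \<in> carrier F" "A \<in> carrier N"
  shows "\<phi> w A = word_class w \<star> move w A \<star> rev_class (word_class w)"
proof -
  obtain \<gamma> where A: "A = path_class X \<gamma>" "path \<gamma>" "path_image \<gamma> \<subseteq> X"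
    using assms(2) by (auto elim: path_classesE)
  then have ends: "pathstart \<gamma> = x\<^sub>0" "pathfinish \<gamma> = x\<^sub>0" using assms by auto
  let ?p = "word_path \<rho> x\<^sub>0 \<alpha> w"
  note w = word_path_props[OF assms(1)]
  have eq: "path_class X (?p +++ ((\<rho> w \<circ> \<gamma>') +++ reversepath ?p)) = word_class w \<star> move w A \<star> rev_class (word_class w)"
    if "homotopic_paths X \<gamma> \<gamma>'" for \<gamma>'
  proof -
    have "A = path_class X \<gamma>'" using A(1) path_class_eqI[OF that] by simp
    moreover have "path \<gamma>'" "path_image \<gamma>' \<subseteq> X" "pathstart \<gamma>' = x\<^sub>0" "pathfinish \<gamma>' = x\<^sub>0"
      using that ends homotopic_paths_imp_path homotopic_paths_imp_subset
        homotopic_paths_imp_pathstart homotopic_paths_imp_pathfinish by metis+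
    ultimately show ?thesis
      using w assms(1) path_compose[of \<gamma>' X "\<rho> w"]
      by (simp add: class_map_path_class class_join_path_class class_reverse_path_class
          pathstart_compose pathfinish_compose subset_path_image_join)
  qed
  have "\<phi> w A = path_class X (?p +++ ((\<rho> w \<circ> \<gamma>) +++ reversepath ?p))"
    unfolding word_automorphism_def A(1)
    using A eq by (intro UN_path_class) auto
  then show ?thesis using eq A by simp
qed

lemma group_N: "group N"
  using base by (rule group_fundamental_group)

text \<open>Each \<open>\<phi> w\<close> respects products of loops because the inner alpha_w^*
  alpha_w cancels, and \<open>\<phi>\<close> respects products of words by the cocycle
  identity.\<close>

lemma group_W: "group W"
  unfolding ambient_group_def
proof (rule group_semidirect_product[OF group_N group_free_group])
  show "\<phi> w \<in> hom N N" if w: "w \<in> carrier F" for w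
    using w base by (intro homI) (auto simp: word_automorphism_eq fundamental_group_simps(2))
  show "\<phi> (u \<otimes>\<^bsub>F\<^esub> v) n = \<phi> u (\<phi> v n)"
    if "u \<in> carrier F" "v \<in> carrier F" "n \<in> carrier N" for u v n
    using that base by (auto simp: word_automorphism_eq word_class_mult)
  show "\<phi> \<one>\<^bsub>F\<^esub> n = n" if "n \<in> carrier N" for n
    using that base by (simp add: word_automorphism_eq word_class_one del: one_F)
qed

sublocale W: group W by (rule group_W)


lemma W_simps:
  "carrier W = carrier N \<times> carrier F"
  "(n, u) \<otimes>\<^bsub>W\<^esub> (m, v) = (n \<star> \<phi> u m, u \<otimes>\<^bsub>F\<^esub> v)"
  "\<one>\<^bsub>W\<^esub> = (class_const X x\<^sub>0, \<one>\<^bsub>F\<^esub>)"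
  by (simp_all add: ambient_group_def semidirect_product_def fundamental_group_simps)

lemma group_hom_snd: "group_hom W F snd"
  using group_W group_free_group
  by (auto simp: group_hom_def group_hom_axioms_def intro!: homI simp: W_simps)

end

section \<open>Relators of a free action as a section over the kernel\<close>

locale free_jumping_data = jumping_data +
  assumes free: "w \<in> carrier (free_group S) \<Longrightarrow> p \<in> X \<Longrightarrow> \<rho> w p = p \<Longrightarrow> x \<in> X \<Longrightarrow> \<rho> w x = x"
begin

text \<open>This is the kernel of the map from the free group to the acting group, described through
  the action alone. By \<open>free\<close>, a word that fixes one point already belongs to
  it.\<close>

definition K where "K = {w \<in> carrier F. \<forall>x\<in>X. \<rho> w x = x}"

text \<open>For \<open>w\<close> in \<open>K\<close> the path alpha_w ends at w x_0 = x_0, so its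
  reverse is a loop and the pair lies in \<open>W\<close>.\<close>

definition \<sigma> where "\<sigma> w = (rev_class (word_class w), w)"

abbreviation short where "short \<theta> \<equiv> {w \<in> K. length w \<le> 4 * \<theta>}"

abbreviation relators where "relators \<equiv> relator_subgroup X S \<rho> x\<^sub>0 \<alpha>"

lemma K_I: "w \<in> carrier F \<Longrightarrow> (\<And>x. x \<in> X \<Longrightarrow> \<rho> w x = x) \<Longrightarrow> w \<in> K"
  by (simp add: K_def)

lemma K_D [simp]:
  assumes "w \<in> K"
  shows "w \<in> carrier F" "x \<in> X \<Longrightarrow> \<rho> w x = x" "A \<in> path_classes X \<Longrightarrow> move w A = A"
  using assms class_map_id[of A X "\<rho> w"] by (simp_all add: K_def)

lemma fixed_point_relators_eq: "fixed_point_relators X S \<rho> x\<^sub>0 \<alpha> \<theta> = \<sigma> ` short \<theta>"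
proof -
  have eq: "path_class X (\<beta> +++ ((\<rho> w \<circ> reversepath \<beta>) +++ reversepath (word_path \<rho> x\<^sub>0 \<alpha> w))) = rev_class (word_class w)"
    if w: "w \<in> K" and \<beta>: "path_in X x\<^sub>0 p \<beta>" for w p \<beta>
  proof -
    let ?B = "path_class X \<beta>"
    have p: "p \<in> X"
      using \<beta> pathfinish_in_path_image[of \<beta>] by (auto simp: path_in_def)
    have "path_class X (\<beta> +++ ((\<rho> w \<circ> reversepath \<beta>) +++ reversepath (word_path \<rho> x\<^sub>0 \<alpha> w)))
        = ?B \<star> move w (rev_class ?B) \<star> rev_class (word_class w)"
      using w \<beta> p base word_path_props[of w] path_compose[of "reversepath \<beta>" X "\<rho> w"]
      by (simp add: path_in_def class_map_path_class class_join_path_class class_reverse_path_class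
          pathstart_compose pathfinish_compose subset_path_image_join)
    also have "\<dots> = ?B \<star> rev_class ?B \<star> rev_class (word_class w)"
      using w \<beta> by (simp add: path_in_def)
    also have "\<dots> = rev_class (word_class w)"
      using w \<beta> base by (simp add: path_in_def)
    finally show ?thesis .
  qed
  show ?thesis
  proof (intro equalityI subsetI)
    fix z assume "z \<in> fixed_point_relators X S \<rho> x\<^sub>0 \<alpha> \<theta>"
    then obtain w \<beta> p where "z = (path_class X (\<beta> +++ ((\<rho> w \<circ> reversepath \<beta>) +++ reversepath (word_path \<rho> x\<^sub>0 \<alpha> w))), w)"
        "w \<in> carrier F" "length w \<le> 4 * \<theta>" "p \<in> X" "\<rho> w p = p" "path_in X x\<^sub>0 p \<beta>"
      unfolding fixed_point_relators_def by blast
    moreover from this have "w \<in> K" using free[of w p] by (intro K_I)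
    ultimately show "z \<in> \<sigma> ` short \<theta>" using eq by (auto simp: \<sigma>_def)
  next
    fix z assume "z \<in> \<sigma> ` short \<theta>"
    then obtain w where w: "z = \<sigma> w" "w \<in> K" "length w \<le> 4 * \<theta>" by auto
    have "path_in X x\<^sub>0 x\<^sub>0 (\<lambda>_. x\<^sub>0)"
      using base by (simp add: path_in_def pathstart_def pathfinish_def)
    then show "z \<in> fixed_point_relators X S \<rho> x\<^sub>0 \<alpha> \<theta>"
      unfolding fixed_point_relators_def using w base eq[of w x\<^sub>0 "\<lambda>_. x\<^sub>0"]
      by (intro CollectI exI[of _ w] exI[of _ "\<lambda>_. x\<^sub>0"] exI[of _ x\<^sub>0]) (simp add: \<sigma>_def)
  qed
qed

lemma section_closed [simp]: "w \<in> K \<Longrightarrow> \<sigma> w \<in> carrier W"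
  using base by (simp add: \<sigma>_def W_simps)

lemma K_closed:
  shows "\<one>\<^bsub>F\<^esub> \<in> K" "u \<in> K \<Longrightarrow> v \<in> K \<Longrightarrow> u \<otimes>\<^bsub>F\<^esub> v \<in> K" "u \<in> K \<Longrightarrow> inv\<^bsub>F\<^esub> u \<in> K"
    "w \<in> carrier F \<Longrightarrow> u \<in> K \<Longrightarrow> w \<otimes>\<^bsub>F\<^esub> u \<otimes>\<^bsub>F\<^esub> inv\<^bsub>F\<^esub> w \<in> K"
proof -
  have inv_act: "\<rho> w (\<rho> (inv\<^bsub>F\<^esub> w) x) = x" "\<rho> (inv\<^bsub>F\<^esub> w) (\<rho> w x) = x" if "w \<in> carrier F" "x \<in> X" for w x
    using that act_mult[of w "inv\<^bsub>F\<^esub> w" x] act_mult[of "inv\<^bsub>F\<^esub> w" w x] act_one[of x]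
    by (simp_all del: act_mult act_one)
  show "\<one>\<^bsub>F\<^esub> \<in> K" by (rule K_I) simp_all
  show "u \<otimes>\<^bsub>F\<^esub> v \<in> K" if "u \<in> K" "v \<in> K" using that by (intro K_I) simp_all
  show "inv\<^bsub>F\<^esub> u \<in> K" if "u \<in> K"
  proof (rule K_I)
    show "\<rho> (inv\<^bsub>F\<^esub> u) x = x" if "x \<in> X" for x
      using \<open>u \<in> K\<close> that inv_act(2)[of u x] by simp
  qed (use that in simp)
  show "w \<otimes>\<^bsub>F\<^esub> u \<otimes>\<^bsub>F\<^esub> inv\<^bsub>F\<^esub> w \<in> K" if "w \<in> carrier F" "u \<in> K"
    using that inv_act(1)[of w] by (intro K_I) simp_all
qed

lemma section_mult:
  assumes "u \<in> K" "v \<in> K"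
  shows "\<sigma> (u \<otimes>\<^bsub>F\<^esub> v) = \<sigma> u \<otimes>\<^bsub>W\<^esub> \<sigma> v"
  using assms base by (simp add: \<sigma>_def W_simps word_automorphism_eq word_class_mult)

lemma section_one: "\<sigma> \<one>\<^bsub>F\<^esub> = \<one>\<^bsub>W\<^esub>"
  using base by (simp add: \<sigma>_def W_simps word_class_one)

lemma section_inv:
  assumes "u \<in> K"
  shows "\<sigma> (inv\<^bsub>F\<^esub> u) = inv\<^bsub>W\<^esub> \<sigma> u"
proof (rule W.inv_equality[symmetric])
  show "\<sigma> (inv\<^bsub>F\<^esub> u) \<otimes>\<^bsub>W\<^esub> \<sigma> u = \<one>\<^bsub>W\<^esub>"
    using assms K_closed(3) by (simp add: section_one flip: section_mult)
qed (use assms K_closed(3) in auto)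

lemma section_conj:
  assumes u: "u \<in> carrier F" and w: "w \<in> K"
  defines "g \<equiv> (class_const X x\<^sub>0, u)"
  shows "\<sigma> (u \<otimes>\<^bsub>F\<^esub> w \<otimes>\<^bsub>F\<^esub> inv\<^bsub>F\<^esub> u) = g \<otimes>\<^bsub>W\<^esub> \<sigma> w \<otimes>\<^bsub>W\<^esub> inv\<^bsub>W\<^esub> g"
proof -
  let ?w = "u \<otimes>\<^bsub>F\<^esub> w \<otimes>\<^bsub>F\<^esub> inv\<^bsub>F\<^esub> u"
  have w': "?w \<in> K" using K_closed(4)[OF u w] .
  have g: "g \<in> carrier W" using u base by (simp add: g_def W_simps)
  \<comment> \<open>The cocycle identity is evaluated on both sides of this equation. Since
    \<open>?w\<close> acts trivially, the result is alpha_{?w} alpha_u = alpha_u u(alpha_w), which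
    is solved for alpha_{?w}.\<close>
  have wu: "?w \<otimes>\<^bsub>F\<^esub> u = u \<otimes>\<^bsub>F\<^esub> w" using u w by (simp add: F.m_assoc)
  have "word_class ?w \<star> word_class u = word_class (?w \<otimes>\<^bsub>F\<^esub> u)"
    using u w' by (subst word_class_mult) auto
  also have "\<dots> = word_class u \<star> move u (word_class w)"
    unfolding wu using u w by (subst word_class_mult) auto
  finally have "(word_class ?w \<star> word_class u) \<star> rev_class (word_class u) = (word_class u \<star> move u (word_class w)) \<star> rev_class (word_class u)"
    by simp
  then have "word_class ?w = word_class u \<star> move u (word_class w) \<star> rev_class (word_class u)"
    using u w w' base by simp
  then have conj: "\<phi> u (rev_class (word_class w)) = rev_class (word_class ?w)"
    using u w base by (simp add: word_automorphism_eq)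
  have "\<phi> ?w (class_const X x\<^sub>0) = class_const X x\<^sub>0"
    using w' base by (simp add: word_automorphism_eq)
  \<comment> \<open>Comparing the two products with \<open>g\<close> avoids computing the inverse of
    \<open>g\<close> in the semidirect product.\<close>
  with conj have "\<sigma> ?w \<otimes>\<^bsub>W\<^esub> g = g \<otimes>\<^bsub>W\<^esub> \<sigma> w"
    using w' base wu by (simp add: \<sigma>_def g_def W_simps)
  then show ?thesis
    using g w w' by (metis W.inv_solve_right W.m_closed section_closed)
qed

text \<open>Invariance holds under all of \<open>F\<close>, not just \<open>K\<close>, because
  conjugating \<open>w\<close> by \<open>u\<close> conjugates \<open>\<sigma> w\<close> by an
  element of \<open>W\<close>.\<close>

lemma normal_section_preimage:
  assumes "M \<lhd> W"
  shows "{w \<in> K. \<sigma> w \<in> M} \<lhd> F"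
proof (rule F.normal_invI)
  interpret M: normal M W by fact
  show "subgroup {w \<in> K. \<sigma> w \<in> M} F"
    using K_closed(1,2,3) section_one
    by (intro F.subgroupI) (auto simp: section_mult section_inv)
  fix u w assume "u \<in> carrier F" "w \<in> {w \<in> K. \<sigma> w \<in> M}"
  then show "u \<otimes>\<^bsub>F\<^esub> w \<otimes>\<^bsub>F\<^esub> inv\<^bsub>F\<^esub> u \<in> {w \<in> K. \<sigma> w \<in> M}"
    using base by (auto simp: section_conj K_closed(4) W_simps intro!: M.inv_op_closed2)
qed

lemma relators_eq: "relators \<theta> = normal_closure W (\<sigma> ` short \<theta>)"
  by (simp add: relator_subgroup_def fixed_point_relators_eq)

lemma normal_relators: "relators \<theta> \<lhd> W"
  unfolding relators_eq by (rule W.normal_normal_closure) auto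

lemma relators_mono: "\<theta> \<le> \<theta>' \<Longrightarrow> relators \<theta> \<subseteq> relators \<theta>'"
  unfolding relators_eq by (rule W.normal_closure_mono) auto

text \<open>Forwards, the projection \<open>snd\<close> sends \<open>\<sigma> w\<close> to
  \<open>w\<close> and the relators to short words. Backwards, the preimage of
  \<open>relators \<theta>\<close> under \<open>\<sigma>\<close> is normal in \<open>F\<close> and
  contains the short words.\<close>

lemma section_in_relators_iff:
  assumes "w \<in> K"
  shows "\<sigma> w \<in> relators \<theta> \<longleftrightarrow> w \<in> normal_closure F (short \<theta>)"
proof
  interpret snd: group_hom W F snd by (rule group_hom_snd)
  have short: "short \<theta> \<subseteq> carrier F" by auto
  assume "\<sigma> w \<in> relators \<theta>"
  then have "snd (\<sigma> w) \<in> normal_closure F (short \<theta>)"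
    unfolding relators_eq using subset_normal_closure[of "short \<theta>" F] section_closed
    by (intro snd.hom_normal_closure[OF F.normal_normal_closure[OF short]]) (auto simp: \<sigma>_def)
  then show "w \<in> normal_closure F (short \<theta>)" by (simp add: \<sigma>_def)
next
  assume "w \<in> normal_closure F (short \<theta>)"
  moreover have "short \<theta> \<subseteq> {w \<in> K. \<sigma> w \<in> relators \<theta>}"
    using subset_normal_closure[of "\<sigma> ` short \<theta>" W] by (auto simp: relators_eq)
  ultimately show "\<sigma> w \<in> relators \<theta>"
    using normal_closure_minimal[OF normal_section_preimage[OF normal_relators]] by blast
qed

lemma stable_iff:
  "stable_discrete_fundamental_group X S \<rho> x\<^sub>0 \<alpha> \<longleftrightarrow> (\<exists>\<theta>\<ge>1. K \<subseteq> normal_closure F (short \<theta>))"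
proof -
  let ?H = "discrete_fundamental_group X S \<rho> x\<^sub>0 \<alpha>"
  let ?f = "transition_map X S \<rho> x\<^sub>0 \<alpha>"
  interpret directed_system "{1..}" ?H ?f
    unfolding discrete_fundamental_group_def[abs_def] transition_map_def[abs_def]
    by (rule W.directed_system_quotients) (use normal_relators relators_mono in auto)
  have f: "?f i j (relators i #>\<^bsub>W\<^esub> x) = relators j #>\<^bsub>W\<^esub> x" if "i \<le> j" "x \<in> carrier W" for i j x
    unfolding transition_map_def
    using that by (intro W.normal_set_mult_rcos normal_relators relators_mono)
  have H: "carrier (?H i) = {relators i #>\<^bsub>W\<^esub> x | x. x \<in> carrier W}" for i
    by (auto simp: discrete_fundamental_group_def FactGroup_def RCOSETS_def)
  show ?thesis
    unfolding stable_discrete_fundamental_group_def Let_def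
  proof (intro iffI; elim exE conjE)
    fix \<theta> :: nat assume \<theta>: "1 \<le> \<theta>" and iso: "direct_limit_map {1..} ?H ?f \<theta> \<in> iso (?H \<theta>) (direct_limit {1..} ?H ?f)"
    have "K \<subseteq> normal_closure F (short \<theta>)"
    proof
      fix w assume w: "w \<in> K"
      \<comment> \<open>At this stage \<open>w\<close> is short, so \<open>\<sigma> w\<close> is
        itself a relator. Injectivity of the transition map carries its triviality back to stage
        \<open>\<theta>\<close>.\<close>
      define j where "j = max \<theta> (length w)"
      interpret Nj: normal "relators j" W by (rule normal_relators)
      interpret N\<theta>: normal "relators \<theta>" W by (rule normal_relators)
      have "inj_on (?f \<theta> j) (carrier (?H \<theta>))"
        using iso \<theta> by (intro direct_limit_map_inj_imp_trans_inj) (auto simp: iso_def bij_betw_def j_def)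
      moreover have "\<sigma> w \<in> relators j"
        unfolding relators_eq using w subset_normal_closure[of "\<sigma> ` short j" W] by (auto simp: j_def)
      then have "relators j #>\<^bsub>W\<^esub> \<sigma> w = relators j #>\<^bsub>W\<^esub> \<one>\<^bsub>W\<^esub>"
        by (simp add: Nj.rcos_const W.is_group)
      then have "?f \<theta> j (relators \<theta> #>\<^bsub>W\<^esub> \<sigma> w) = ?f \<theta> j (relators \<theta> #>\<^bsub>W\<^esub> \<one>\<^bsub>W\<^esub>)"
        using w by (simp add: f j_def)
      ultimately have "relators \<theta> #>\<^bsub>W\<^esub> \<sigma> w = relators \<theta> #>\<^bsub>W\<^esub> \<one>\<^bsub>W\<^esub>"
        using w section_closed[OF w] W.one_closed unfolding H by (elim inj_onD) blast+
      then have "\<sigma> w \<in> relators \<theta>"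
        using w W.rcos_self[OF section_closed[OF w] N\<theta>.subgroup_axioms] by (simp add: N\<theta>.subset)
      then show "w \<in> normal_closure F (short \<theta>)" using w by (simp add: section_in_relators_iff)
    qed
    with \<theta> show "\<exists>\<theta>\<ge>1. K \<subseteq> normal_closure F (short \<theta>)" by blast
  next
    fix \<theta> :: nat assume \<theta>: "1 \<le> \<theta>" and K: "K \<subseteq> normal_closure F (short \<theta>)"
    \<comment> \<open>Every later relator is the image of an element of \<open>K\<close>, hence
      already lies in \<open>relators \<theta>\<close>. From here on the quotients coincide and the
      transition maps are identities.\<close>
    have eq: "relators j = relators \<theta>" if "\<theta> \<le> j" for j
    proof
      have "\<sigma> ` short j \<subseteq> relators \<theta>" using K by (auto simp: section_in_relators_iff)
      then show "relators j \<subseteq> relators \<theta>"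
        unfolding relators_eq[of j] by (intro normal_closure_minimal normal_relators)
    qed (use that relators_mono in blast)
    have "bij_betw (?f \<theta> j) (carrier (?H \<theta>)) (carrier (?H j))" if "\<theta> \<le> j" for j
    proof -
      have "?f \<theta> j C = C" if "C \<in> carrier (?H \<theta>)" for C
        using that f[OF \<open>\<theta> \<le> j\<close>] eq[OF \<open>\<theta> \<le> j\<close>] by (auto simp: H)
      moreover have "carrier (?H j) = carrier (?H \<theta>)" using eq[OF that] by (simp add: H)
      ultimately show ?thesis by (simp add: bij_betw_def inj_on_def)
    qed
    then have "\<kappa> \<theta> \<in> iso (?H \<theta>) L"
      using \<theta> by (intro direct_limit_map_iso) auto
    then show "\<exists>\<theta>\<ge>1. direct_limit_map {1..} ?H ?f \<theta> \<in> iso (?H \<theta>) (direct_limit {1..} ?H ?f)"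
      using \<theta> by blast
  qed
qed

end

section \<open>Stability and finite presentability\<close>

theorem lemma8p7:
  fixes X :: "'a::metric_space set"
    and \<Gamma> :: "('g, 'm) monoid_scheme"
    and S :: "'s set"
    and \<iota> :: "'s \<Rightarrow> 'g"
    and R :: "'s letter list set"
    and act :: "'g \<Rightarrow> 'a \<Rightarrow> 'a"
    and x\<^sub>0 :: 'a
    and \<alpha> :: "'s \<Rightarrow> real \<Rightarrow> 'a"
  assumes "finite S"
    and "is_presentation \<Gamma> S \<iota> R"
    and "action_by_homeomorphisms \<Gamma> X act"
    and "free_action \<Gamma> X act"
    and "warped_system X S (induced_action \<Gamma> \<iota> act)"
    and "x\<^sub>0 \<in> X"
    and "\<And>s. s \<in> S \<Longrightarrow> path_in X x\<^sub>0 (act (\<iota> s) x\<^sub>0) (\<alpha> s)"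
  shows "stable_discrete_fundamental_group X S (induced_action \<Gamma> \<iota> act) x\<^sub>0 \<alpha>
    \<longleftrightarrow> finitely_presented \<Gamma>"
proof -
  have G: "group \<Gamma>" and \<iota>: "\<iota> \<in> S \<rightarrow> carrier \<Gamma>"
    and sur: "word_value \<Gamma> \<iota> ` carrier (free_group S) = carrier \<Gamma>"
    using assms(2) by (auto simp: is_presentation_def)
  interpret v: group_hom "free_group S" \<Gamma> "word_value \<Gamma> \<iota>" by (rule group_hom_word_value[OF G \<iota>])
  interpret \<Gamma>: group_action \<Gamma> X act
    using assms(3) by (simp add: action_by_homeomorphisms_def)
  have act_one: "act \<one>\<^bsub>\<Gamma>\<^esub> x = x" if "x \<in> X" for x
    using that by (metis \<Gamma>.id_eq_one restrict_apply')
  \<comment> \<open>Freeness enters here: having the fixed point \<open>p\<close> already forces the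
    value of the word to be trivial.\<close>
  have fixes_iff: "induced_action \<Gamma> \<iota> act w p = p \<longleftrightarrow> word_value \<Gamma> \<iota> w = \<one>\<^bsub>\<Gamma>\<^esub>"
    if "w \<in> carrier (free_group S)" "p \<in> X" for w p
    using assms(4) that act_one by (auto simp: free_action_def induced_action_def)
  interpret free_jumping_data X S "induced_action \<Gamma> \<iota> act" x\<^sub>0 \<alpha>
  proof
    show "action_by_homeomorphisms (free_group S) X (induced_action \<Gamma> \<iota> act)"
      by (rule action_by_homeomorphisms_induced_action[OF assms(3) \<iota>])
    show "path_in X x\<^sub>0 (induced_action \<Gamma> \<iota> act [(s, True)] x\<^sub>0) (\<alpha> s)" if "s \<in> S" for s
    proof -
      have "\<iota> s \<in> carrier \<Gamma>" using \<iota> that by auto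
      then show ?thesis
        using assms(7)[OF that] word_value_generator[OF G, of \<iota> s] by (simp add: induced_action_def)
    qed
  qed (use assms(6) fixes_iff in auto)
  \<comment> \<open>The base point witnesses that \<open>X\<close> is nonempty, so a word fixing all
    points does fix some point and has trivial value.\<close>
  have K: "K = kernel (free_group S) \<Gamma> (word_value \<Gamma> \<iota>)"
    unfolding K_def kernel_def using assms(6) fixes_iff by blast
  have "(\<exists>\<theta>\<ge>1. K \<subseteq> normal_closure (free_group S) (short \<theta>)) \<longleftrightarrow> finitely_presented \<Gamma>"
  proof (intro iffI; (elim exE conjE)?)
    fix \<theta> assume "K \<subseteq> normal_closure (free_group S) (short \<theta>)"
    moreover have "normal_closure (free_group S) (short \<theta>) \<subseteq> K"
      unfolding K by (intro normal_closure_minimal v.normal_kernel) auto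
    ultimately have "is_presentation \<Gamma> S \<iota> (short \<theta>)"
      using G \<iota> sur K by (auto simp: is_presentation_def)
    moreover have "finite (short \<theta>)"
    proof (rule finite_subset)
      show "short \<theta> \<subseteq> {w. set w \<subseteq> S \<times> UNIV \<and> length w \<le> 4 * \<theta>}"
      proof
        fix w assume "w \<in> short \<theta>"
        then have "w \<in> carrier (free_group S)" "length w \<le> 4 * \<theta>" by auto
        then show "w \<in> {w. set w \<subseteq> S \<times> UNIV \<and> length w \<le> 4 * \<theta>}"
          by (auto simp: free_group_def)
      qed
      show "finite {w :: 's letter list. set w \<subseteq> S \<times> UNIV \<and> length w \<le> 4 * \<theta>}"
        using assms(1) by (intro finite_lists_length_le) simp
    qed
    ultimately show "finitely_presented \<Gamma>"
      using assms(1) by (rule finite_presentation_reindex)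
  next
    assume "finitely_presented \<Gamma>"
    then obtain S' :: "nat set" and \<iota>' R' where "finite R'" "is_presentation \<Gamma> S' \<iota>' R'"
      by (auto simp: finitely_presented_def)
    \<comment> \<open>The finite presentation may use unrelated generators. It is moved to the given
      system \<open>S\<close>, whose kernel is the one in question.\<close>
    then obtain R'' where R'': "finite R''" "is_presentation \<Gamma> S \<iota> R''"
      using finite_presentation_transfer[OF _ _ assms(1) \<iota> sur] by blast
    then have K': "K = normal_closure (free_group S) R''"
      by (simp add: K is_presentation_def)
    \<comment> \<open>The sum bounds the length of every relator, and the successor ensures that the
      scale is at least 1.\<close>
    define \<theta> where "\<theta> = Suc (\<Sum>w\<in>R''. length w)"
    have "R'' \<subseteq> short \<theta>"
    proof
      fix w assume w: "w \<in> R''"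
      then have "length w \<le> (\<Sum>w\<in>R''. length w)"
        using R''(1) by (intro member_le_sum) auto
      moreover have "w \<in> K" using w K' subset_normal_closure[of R'' "free_group S"] by auto
      ultimately show "w \<in> short \<theta>" by (simp add: \<theta>_def)
    qed
    moreover have "short \<theta> \<subseteq> carrier (free_group S)" by auto
    ultimately have "K \<subseteq> normal_closure (free_group S) (short \<theta>)"
      unfolding K' by (rule v.G.normal_closure_mono)
    then show "\<exists>\<theta>\<ge>1. K \<subseteq> normal_closure (free_group S) (short \<theta>)"
      by (intro exI[of _ \<theta>]) (simp add: \<theta>_def)
  qed
  then show ?thesis by (simp add: stable_iff)
qed

end
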